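(* For any self-adjoint operator $A\,\eta\,\mathcal{Q}''$ and any interval $I=(a,b]$ (with $a<b$ real), we have $[\![\tilde{A}\in\tilde{I}]\!]=E^{A}(I)$.
   Context: Let $\mathcal{H}$ be a Hilbert space and $\mathcal{Q}$ a logic on $\mathcal{H}$, i.e. a set of projections on $\mathcal{H}$ with $\mathcal{Q}=\mathcal{Q}^{!!}$ (equivalently, the projection lattice of the von Neumann algebra $\mathcal{Q}''$), where ${}^{!}$ denotes the commutant within the projection lattice. Let $\mathbf{V}^{(\mathcal{Q})}$ be the $\mathcal{Q}$-valued universe of set theory, with $\mathcal{Q}$-valued truth values $[\![\cdot]\!]$ defined recursively using the Sasaki implication $P\Rightarrow Q=P^{\perp}\vee(P\wedge Q)$. Let $\mathbf{Q}$ be the rationals and $\check{\mathbf{Q}}$ its canonical embedding. The reals of the model are $\mathbf{R}^{(\mathcal{Q})}=\{u\in\mathbf{V}^{(\mathcal{Q})}\mid \mathrm{dom}(u)=\mathrm{dom}(\check{\mathbf{Q}}),\ [\![\mathbf{R}(u)]\!]=1\}$, where $\mathbf{R}(x)$ says $x$ is the upper segment of a Dedekind cut of the rationals. For a self-adjoint operator $A$ affiliated with $\mathcal{Q}''$ (written $A\,\eta\,\mathcal{Q}''$) with resolution of the identity $\{E^{A}(\lambda)\}_{\lambda\in\mathbf{R}}$, define $\tilde{A}\in\mathbf{R}^{(\mathcal{Q})}$ by $\mathrm{dom}(\tilde{A})=\mathrm{dom}(\check{\mathbf{Q}})$ and $\tilde{A}(\check{r})=E^{A}(r)$ for $r\in\mathbf{Q}$.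 For $r\in\mathbf{R}$ define $\tilde{r}\in\mathbf{R}^{(\mathcal{Q})}$ by $\mathrm{dom}(\tilde{r})=\mathrm{dom}(\check{\mathbf{Q}})$ and $\tilde{r}(\check{t})=[\![\check{r}\le\check{t}]\!]$ for $t\in\mathbf{Q}$. For $u,v\in\mathbf{R}^{(\mathcal{Q})}$, "$u\le v$" means "$v\subseteq u$" and "$u<v$" means "$(u\le v)\wedge\neg(u=v)$". For $I=(a,b]$ put $E^{A}(I)=E^{A}(b)-E^{A}(a)$, and define $\tilde{I}\in\mathbf{V}^{(\mathcal{Q})}$ by $\mathrm{dom}(\tilde{I})=\mathbf{R}^{(\mathcal{Q})}$ and $\tilde{I}(u)=[\![\tilde{a}<u]\!]\wedge[\![u\le\tilde{b}]\!]$ for all $u\in\mathbf{R}^{(\mathcal{Q})}$. *)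

theory Defs
  imports "HOL-Analysis.Analysis"
begin

section \<open>Names: hereditarily small sets of pairs (name, value)\<close>

text \<open>
  A tree codes a set of pairs (tree, value) as the range of a partial family indexed by the type
  \<open>'k\<close>; names are trees up to extensional equality.  The resulting type is
  the universe of all well-founded, extensional, \<open>'q\<close>-labelled sets whose
  members and hereditary members have at most \<open>|'k|\<close> elements.  As HOL has no type that contains a
  proper class of sets, the parameter \<open>'k\<close> takes the place of
  ``all sets''; it is kept arbitrary (up to a lower bound on its size) in the end.
\<close>

datatype ('k, 'q) tree = Node "'k \<Rightarrow> (('k, 'q) tree \<times> 'q) option"

inductive teq :: "('k, 'q) tree \<Rightarrow> ('k, 'q) tree \<Rightarrow> bool" where
  teqI: "(\<forall>t q. (t, q) \<in> ran f \<longrightarrow> (\<exists>s. teq t s \<and> (s, q) \<in> ran g)) \<Longrightarrow>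
         (\<forall>s q. (s, q) \<in> ran g \<longrightarrow> (\<exists>t. teq t s \<and> (t, q) \<in> ran f)) \<Longrightarrow>
         teq (Node f) (Node g)"

lemma tree_induct':
  assumes "\<And>f. (\<And>t q. (t, q) \<in> ran f \<Longrightarrow> P t) \<Longrightarrow> P (Node f)"
  shows "P t"
proof (induction t)
  case (Node f)
  show ?case
  proof (rule assms)
    fix t q assume "(t, q) \<in> ran f"
    then obtain k where "f k = Some (t, q)" by (auto simp: ran_def)
    then show "P t"
      by (intro Node[of "f k" "(t, q)"]) (auto simp: image_iff intro: exI[of _ k])
  qed
qed

lemma teq_refl: "teq t t"
  by (induction t rule: tree_induct') (blast intro: teqI)

lemma teq_sym: "teq t s \<Longrightarrow> teq s t"
proof (induction rule: teq.induct)
  case (teqI f g)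
  show ?case by (rule teq.teqI) (use teqI in blast)+
qed

lemma teq_trans: "teq t s \<Longrightarrow> teq s r \<Longrightarrow> teq t r"
proof (induction arbitrary: r rule: teq.induct)
  case (teqI f g)
  from teqI.prems obtain h where r: "r = Node h"
    and h1: "\<forall>t q. (t, q) \<in> ran g \<longrightarrow> (\<exists>s. teq t s \<and> (s, q) \<in> ran h)"
    and h2: "\<forall>s q. (s, q) \<in> ran h \<longrightarrow> (\<exists>t. teq t s \<and> (t, q) \<in> ran g)"
    by (auto elim: teq.cases)
  show ?case unfolding r
  proof (rule teq.teqI; intro allI impI)
    fix t q assume "(t, q) \<in> ran f"
    then obtain s where "\<forall>x. teq s x \<longrightarrow> teq t x" "(s, q) \<in> ran g" using teqI by blast
    then show "\<exists>s. teq t s \<and> (s, q) \<in> ran h" using h1 by blast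
  next
    fix s q assume "(s, q) \<in> ran h"
    then obtain t where t: "teq t s" "(t, q) \<in> ran g" using h2 by blast
    then show "\<exists>t. teq t s \<and> (t, q) \<in> ran f" using teqI by blast
  qed
qed

quotient_type ('k, 'q) name = "('k, 'q) tree" / teq
  by (intro equivpI reflpI sympI transpI) (blast intro: teq_refl teq_sym teq_trans)+

definition graph :: "('k, 'q) name \<Rightarrow> (('k, 'q) name \<times> 'q) set" where
  "graph u = (case rep_name u of Node f \<Rightarrow> (\<lambda>(t, q). (abs_name t, q)) ` ran f)"

definition mk :: "(('k, 'q) name \<times> 'q) set \<Rightarrow> ('k, 'q) name" where
  "mk S = (THE u. graph u = S)"

lemma abs_name_eq: "abs_name t = abs_name s \<longleftrightarrow> teq t s"
  by (rule name.abs_eq_iff)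

lemma graph_abs: "graph (abs_name (Node f)) = (\<lambda>(t, q). (abs_name t, q)) ` ran f"
proof -
  have "teq (rep_name (abs_name (Node f))) (Node f)"
    by (meson Quotient3_name Quotient3_rep_abs teq_refl)
  then obtain g where g: "rep_name (abs_name (Node f)) = Node g"
    "\<forall>t q. (t, q) \<in> ran g \<longrightarrow> (\<exists>s. teq t s \<and> (s, q) \<in> ran f)"
    "\<forall>s q. (s, q) \<in> ran f \<longrightarrow> (\<exists>t. teq t s \<and> (t, q) \<in> ran g)"
    by (auto elim: teq.cases)
  have "(abs_name t, q) \<in> (\<lambda>(t, q). (abs_name t, q)) ` ran f" if tq: "(t, q) \<in> ran g" for t q
  proof -
    obtain s where "teq t s" "(s, q) \<in> ran f" using g(2) tq by blast
    then show ?thesis by (force simp: image_iff abs_name_eq)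
  qed
  moreover have "(abs_name s, q) \<in> (\<lambda>(t, q). (abs_name t, q)) ` ran g" if sq: "(s, q) \<in> ran f" for s q
  proof -
    obtain t where "teq t s" "(t, q) \<in> ran g" using g(3) sq by blast
    then show ?thesis by (force simp: image_iff abs_name_eq intro: teq_sym)
  qed
  ultimately show ?thesis unfolding graph_def g(1) by auto
qed

lemma ex_abs:
  obtains f where "u = abs_name (Node f)"
  by (cases "rep_name u") (metis Quotient3_abs_rep[OF Quotient3_name])

lemma graph_inject: "graph u = graph v \<longleftrightarrow> u = v"
proof
  assume eq: "graph u = graph v"
  obtain f where u: "u = abs_name (Node f)" by (rule ex_abs)
  obtain g where v: "v = abs_name (Node g)" by (rule ex_abs)
  have "teq (Node f) (Node g)"
  proof (rule teqI; intro allI impI)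
    fix t q assume "(t, q) \<in> ran f"
    then have "(abs_name t, q) \<in> graph v" unfolding eq[symmetric] u graph_abs by force
    then show "\<exists>s. teq t s \<and> (s, q) \<in> ran g" unfolding v graph_abs by (auto simp: abs_name_eq)
  next
    fix t q assume "(t, q) \<in> ran g"
    then have "(abs_name t, q) \<in> graph u" unfolding eq v graph_abs by force
    then show "\<exists>s. teq s t \<and> (s, q) \<in> ran f" unfolding u graph_abs
      by (auto simp: abs_name_eq) (blast intro: teq_sym)
  qed
  then show "u = v" by (simp add: u v abs_name_eq)
qed auto

lemma graph_mk:
  fixes S :: "(('k, 'q) name \<times> 'q) set" and e :: "_ \<Rightarrow> 'k"
  assumes "inj_on e S"
  shows "graph (mk S) = S"
proof -
  define f where "f k = (if k \<in> e ` S then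
      Some (rep_name (fst (inv_into S e k)), snd (inv_into S e k)) else None)" for k
  have r: "ran f = (\<lambda>(u, q). (rep_name u, q)) ` S"
  proof (intro set_eqI iffI)
    fix p assume "p \<in> (\<lambda>(u, q). (rep_name u, q)) ` S"
    then obtain y where y: "y \<in> S" "p = (rep_name (fst y), snd y)" by force
    then have "f (e y) = Some p" using assms by (simp add: f_def)
    then show "p \<in> ran f" by (rule ranI)
  next
    fix p assume "p \<in> ran f"
    then obtain k where k: "f k = Some p" by (auto simp: ran_def)
    then have "k \<in> e ` S" by (simp add: f_def split: if_splits)
    moreover from this have "inv_into S e k \<in> S" by (rule inv_into_into)
    ultimately show "p \<in> (\<lambda>(u, q). (rep_name u, q)) ` S"
      using k by (force simp: f_def case_prod_beta)
  qed
  have "graph (abs_name (Node f)) = S"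
    unfolding graph_abs r by (force simp: image_iff Quotient3_abs_rep[OF Quotient3_name])
  then show ?thesis
    unfolding mk_def by (rule theI) (use \<open>graph _ = S\<close> in \<open>simp flip: graph_inject\<close>)
qed

text \<open>For a single-valued graph, a name is a function with domain \<open>ndom u\<close> and values \<open>app u x\<close>.\<close>

definition ndom :: "('k, 'q) name \<Rightarrow> ('k, 'q) name set" where
  "ndom u = Domain (graph u)"

definition app :: "('k, 'q) name \<Rightarrow> ('k, 'q) name \<Rightarrow> 'q" where
  "app u x = (THE q. (x, q) \<in> graph u)"

lemma name_induct:
  assumes "\<And>u. (\<And>x. x \<in> ndom u \<Longrightarrow> P x) \<Longrightarrow> P u"
  shows "P u"
proof -
  have "P (abs_name t)" for t
  proof (induction t rule: tree_induct')
    case (1 f)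
    show ?case by (rule assms) (use 1 in \<open>auto simp: ndom_def graph_abs\<close>)
  qed
  then show ?thesis by (metis name.abs_induct)
qed

lemma wf_ndom: "wf {(x, u). x \<in> ndom u}"
  unfolding wf_def by (auto intro: name_induct)

lemma wf_ndom_pairs:
  "wf {((x, y), (u, v)). x \<in> ndom u \<and> y \<in> ndom v \<or> x \<in> ndom v \<and> y \<in> ndom u}"
proof (rule wfUNIVI)
  fix P :: "('a, 'b) name \<times> ('a, 'b) name \<Rightarrow> bool" and p
  assume step: "\<forall>p. (\<forall>p'. (p', p) \<in> {((x, y), (u, v)).
      x \<in> ndom u \<and> y \<in> ndom v \<or> x \<in> ndom v \<and> y \<in> ndom u} \<longrightarrow> P p') \<longrightarrow> P p"
  have "\<forall>v. P (u, v) \<and> P (v, u)" for u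
  proof (induction u rule: name_induct)
    case (1 u)
    show ?case
    proof (intro allI conjI)
      fix v
      show "P (u, v)" by (rule step[rule_format]) (use 1 in auto)
      show "P (v, u)" by (rule step[rule_format]) (use 1 in auto)
    qed
  qed
  then show "P p" by (cases p) auto
qed


section \<open>Truth values\<close>

unbundle lattice_syntax

definition sasaki :: "'q \<Rightarrow> 'q \<Rightarrow> 'q::{complete_lattice, uminus}"  (infixr "\<rightarrow>\<^sub>S" 60) where
  "P \<rightarrow>\<^sub>S Q = - P \<squnion> (P \<sqinter> Q)"

text \<open>The mutual recursion for \<open>=\<close> and \<open>\<in>\<close>, with the clause for \<open>\<in>\<close> substituted into the one for
  \<open>=\<close>; see \<open>eqv_mem\<close> below for the usual form.\<close>

function eqv :: "('k, 'q::{complete_lattice, uminus}) name \<Rightarrow> ('k, 'q) name \<Rightarrow> 'q" where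
  "eqv u v = (\<Sqinter>x\<in>ndom u. app u x \<rightarrow>\<^sub>S (\<Squnion>y\<in>ndom v. app v y \<sqinter> eqv x y)) \<sqinter>
             (\<Sqinter>y\<in>ndom v. app v y \<rightarrow>\<^sub>S (\<Squnion>x\<in>ndom u. app u x \<sqinter> eqv y x))"
  by pat_completeness auto
termination by (relation "{((x, y), (u, v)). x \<in> ndom u \<and> y \<in> ndom v \<or> x \<in> ndom v \<and> y \<in> ndom u}")
    (auto intro: wf_ndom_pairs)

declare eqv.simps [simp del]

definition mem :: "('k, 'q::{complete_lattice, uminus}) name \<Rightarrow> ('k, 'q) name \<Rightarrow> 'q" where
  "mem u v = (\<Squnion>y\<in>ndom v. app v y \<sqinter> eqv u y)"

lemma eqv_mem:
  "eqv u v = (\<Sqinter>x\<in>ndom u. app u x \<rightarrow>\<^sub>S mem x v) \<sqinter> (\<Sqinter>y\<in>ndom v. app v y \<rightarrow>\<^sub>S mem y u)"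
  by (subst eqv.simps) (simp add: mem_def)

definition all_in :: "('k, 'q) name \<Rightarrow> (('k, 'q) name \<Rightarrow> 'q) \<Rightarrow> 'q::{complete_lattice, uminus}" where
  "all_in u \<phi> = (\<Sqinter>x\<in>ndom u. app u x \<rightarrow>\<^sub>S \<phi> x)"

definition ex_in :: "('k, 'q) name \<Rightarrow> (('k, 'q) name \<Rightarrow> 'q) \<Rightarrow> 'q::{complete_lattice, uminus}" where
  "ex_in u \<phi> = (\<Squnion>x\<in>ndom u. app u x \<sqinter> \<phi> x)"

definition iff :: "'q \<Rightarrow> 'q \<Rightarrow> 'q::{complete_lattice, uminus}" where
  "iff P Q = (P \<rightarrow>\<^sub>S Q) \<sqinter> (Q \<rightarrow>\<^sub>S P)"

definition subset_val :: "('k, 'q::{complete_lattice, uminus}) name \<Rightarrow> ('k, 'q) name \<Rightarrow> 'q" where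
  "subset_val u v = all_in u (\<lambda>x. mem x v)"


section \<open>The universe over a set of truth values, and the embedding of the ground universe\<close>

inductive_set universe :: "'q set \<Rightarrow> ('k, 'q) name set" for Q where
  "single_valued (graph u) \<Longrightarrow> (\<forall>x \<in> ndom u. x \<in> universe Q \<and> app u x \<in> Q) \<Longrightarrow> u \<in> universe Q"

text \<open>With one-element label type, names are ordinary sets.\<close>

type_synonym 'k V = "('k, unit) name"

function check :: "'k V \<Rightarrow> ('k, 'q::top) name" where
  "check x = mk ((\<lambda>y. (check y, top)) ` ndom x)"
  by pat_completeness auto
termination by (relation "{(x, u). x \<in> ndom u}") (auto intro: wf_ndom)

declare check.simps [simp del]

text \<open>The set whose members are the elements of \<open>S\<close>, all with value \<open>1\<close>; used for \<open>V\<close> and for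
  the \<open>\<Q>\<close>-valued universe alike, as is the Kuratowski pair built from it.\<close>

definition nset :: "('k, 'q::top) name set \<Rightarrow> ('k, 'q) name" where
  "nset S = mk ((\<lambda>x. (x, top)) ` S)"

definition kpair :: "('k, 'q::top) name \<Rightarrow> ('k, 'q) name \<Rightarrow> ('k, 'q) name" where
  "kpair x y = nset {nset {x}, nset {x, y}}"


section \<open>Rationals and reals in the model\<close>

text \<open>In the following, \<open>\<rho> :: rat \<Rightarrow> 'k V\<close> is the set-theoretic construction of the rational numbers; any
  injective \<open>\<rho>\<close> will do.\<close>

definition ratset :: "(rat \<Rightarrow> 'k V) \<Rightarrow> 'k V" where
  "ratset \<rho> = nset (range \<rho>)"

definition ratless :: "(rat \<Rightarrow> 'k V) \<Rightarrow> 'k V" where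
  "ratless \<rho> = nset {kpair (\<rho> r) (\<rho> s) | r s. r < s}"

definition less_val :: "(rat \<Rightarrow> 'k V) \<Rightarrow> ('k, 'q::{complete_lattice, uminus}) name \<Rightarrow> ('k, 'q) name \<Rightarrow> 'q"
  where "less_val \<rho> y z = mem (kpair y z) (check (ratless \<rho>))"

text \<open>\<open>u\<close> is the upper segment of a Dedekind cut of the rationals whose lower segment has no end point:
  \<open>\<forall>y\<in>u. y \<in> \<rat>\<close>, \<open>\<exists>y\<in>\<rat>. y \<in> u\<close>, \<open>\<exists>y\<in>\<rat>. y \<notin> u\<close>, and \<open>\<forall>y\<in>\<rat>. y \<in> u \<longleftrightarrow> (\<forall>z\<in>\<rat>. y < z \<longrightarrow> z \<in> u)\<close>.\<close>

definition real_val :: "(rat \<Rightarrow> 'k V) \<Rightarrow> ('k, 'q::{complete_lattice, uminus}) name \<Rightarrow> 'q" where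
  "real_val \<rho> u =
     all_in u (\<lambda>y. mem y (check (ratset \<rho>))) \<sqinter>
     ex_in (check (ratset \<rho>)) (\<lambda>y. mem y u) \<sqinter>
     ex_in (check (ratset \<rho>)) (\<lambda>y. - mem y u) \<sqinter>
     all_in (check (ratset \<rho>)) (\<lambda>y. iff (mem y u)
       (all_in (check (ratset \<rho>)) (\<lambda>z. less_val \<rho> y z \<rightarrow>\<^sub>S mem z u)))"

definition reals :: "'q::{complete_lattice, uminus} set \<Rightarrow> (rat \<Rightarrow> 'k V) \<Rightarrow> ('k, 'q) name set" where
  "reals Q \<rho> = {u \<in> universe Q. ndom u = ndom (check (ratset \<rho>)) \<and> real_val \<rho> u = top}"

definition le_val :: "('k, 'q::{complete_lattice, uminus}) name \<Rightarrow> ('k, 'q) name \<Rightarrow> 'q" where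
  "le_val u v = subset_val v u"

definition lt_val :: "('k, 'q::{complete_lattice, uminus}) name \<Rightarrow> ('k, 'q) name \<Rightarrow> 'q" where
  "lt_val u v = le_val u v \<sqinter> - eqv u v"

definition rat_fun :: "(rat \<Rightarrow> 'k V) \<Rightarrow> (rat \<Rightarrow> 'q::top) \<Rightarrow> ('k, 'q) name" where
  "rat_fun \<rho> f = mk (range (\<lambda>t. (check (\<rho> t), f t)))"

text \<open>The real number \<open>a\<close> as a set in \<open>V\<close>: the upper segment of its Dedekind cut.\<close>

definition cut :: "(rat \<Rightarrow> 'k V) \<Rightarrow> real \<Rightarrow> 'k V" where
  "cut \<rho> a = nset (\<rho> ` {r. a \<le> of_rat r})"

text \<open>In the truth value of \<open>a \<le> t\<close> below, \<open>t\<close> occurs as a real number, hence as a cut.\<close>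

definition real_name :: "(rat \<Rightarrow> 'k V) \<Rightarrow> real \<Rightarrow> ('k, 'q::{complete_lattice, uminus}) name" where
  "real_name \<rho> a = rat_fun \<rho> (\<lambda>t. le_val (check (cut \<rho> a)) (check (cut \<rho> (of_rat t))))"

definition interval_name ::
  "'q::{complete_lattice, uminus} set \<Rightarrow> (rat \<Rightarrow> 'k V) \<Rightarrow> real \<Rightarrow> real \<Rightarrow> ('k, 'q) name" where
  "interval_name Q \<rho> a b =
     mk ((\<lambda>u. (u, lt_val (real_name \<rho> a) u \<sqinter> le_val u (real_name \<rho> b))) ` reals Q \<rho>)"


section \<open>Complex Hilbert spaces\<close>

class complex_hilbert = banach +
  fixes scaleC :: "complex \<Rightarrow> 'a \<Rightarrow> 'a"  (infixr "*\<^sub>C" 75)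
    and cinner :: "'a \<Rightarrow> 'a \<Rightarrow> complex"
  assumes scaleC_add_right: "c *\<^sub>C (x + y) = c *\<^sub>C x + c *\<^sub>C y"
    and scaleC_add_left: "(c + d) *\<^sub>C x = c *\<^sub>C x + d *\<^sub>C x"
    and scaleC_scaleC: "c *\<^sub>C d *\<^sub>C x = (c * d) *\<^sub>C x"
    and scaleC_of_real: "complex_of_real r *\<^sub>C x = r *\<^sub>R x"
    and cinner_commute: "cinner x y = cnj (cinner y x)"
    and cinner_add_right: "cinner x (y + z) = cinner x y + cinner x z"
    and cinner_scaleC_right: "cinner x (c *\<^sub>C y) = c * cinner x y"
    and cinner_self: "cinner x x = complex_of_real ((norm x)\<^sup>2)"

instantiation complex :: complex_hilbert
begin
definition "scaleC_complex c (x::complex) = c * x"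
definition "cinner_complex x (y::complex) = cnj x * y"
instance
  by standard
    (auto simp: scaleC_complex_def cinner_complex_def algebra_simps scaleR_conv_of_real
      complex_norm_square[symmetric])
end

definition clinear :: "('a::complex_hilbert \<Rightarrow> 'a) \<Rightarrow> bool" where
  "clinear T \<longleftrightarrow> (\<forall>x y. T (x + y) = T x + T y) \<and> (\<forall>c x. T (c *\<^sub>C x) = c *\<^sub>C T x)"

definition csubspace :: "'a::complex_hilbert set \<Rightarrow> bool" where
  "csubspace S \<longleftrightarrow> 0 \<in> S \<and> (\<forall>x\<in>S. \<forall>y\<in>S. x + y \<in> S) \<and> (\<forall>c. \<forall>x\<in>S. c *\<^sub>C x \<in> S)"

definition bounded_op :: "('a::complex_hilbert \<Rightarrow> 'a) \<Rightarrow> bool" where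
  "bounded_op T \<longleftrightarrow> clinear T \<and> bounded_linear T"

definition unitary :: "('a::complex_hilbert \<Rightarrow> 'a) \<Rightarrow> bool" where
  "unitary U \<longleftrightarrow> clinear U \<and> surj U \<and> (\<forall>x y. cinner (U x) (U y) = cinner x y)"


subsection \<open>Geometry\<close>

lemma csubspace_diff:
  assumes "csubspace S" "x \<in> S" "y \<in> S" shows "x - y \<in> S"
proof -
  have "x + (complex_of_real (-1)) *\<^sub>C y \<in> S" using assms unfolding csubspace_def by blast
  then show ?thesis unfolding scaleC_of_real by simp
qed

lemma csubspace_scaleR:
  assumes "csubspace S" "x \<in> S" shows "r *\<^sub>R x \<in> S"
  using assms unfolding csubspace_def by (metis scaleC_of_real)

lemma cinner_add_left: "cinner (x + y) z = cinner x z + cinner y (z::'a::complex_hilbert)"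
  by (metis cinner_add_right cinner_commute complex_cnj_add)

lemma cinner_scaleC_left: "cinner (c *\<^sub>C x) y = cnj c * cinner x (y::'a::complex_hilbert)"
  by (metis cinner_scaleC_right cinner_commute complex_cnj_mult)

lemma cinner_minus_right: "cinner x (- y) = - cinner x (y::'a::complex_hilbert)"
proof -
  have "cinner x ((complex_of_real (-1)) *\<^sub>C y) = - cinner x y"
    unfolding cinner_scaleC_right by simp
  then show ?thesis unfolding scaleC_of_real by simp
qed

lemma cinner_minus_left: "cinner (- x) y = - cinner x (y::'a::complex_hilbert)"
  by (metis cinner_minus_right cinner_commute complex_cnj_minus)

lemma cinner_diff_right: "cinner x (y - z) = cinner x y - cinner x (z::'a::complex_hilbert)"
  using cinner_add_right[of x y "- z"] by (simp add: cinner_minus_right)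

lemma cinner_diff_left: "cinner (x - y) z = cinner x z - cinner y (z::'a::complex_hilbert)"
  using cinner_add_left[of x "- y" z] by (simp add: cinner_minus_left)

lemma norm_sq: "(norm (x::'a::complex_hilbert))\<^sup>2 = Re (cinner x x)"
  by (simp add: cinner_self)

lemma cinner_eq_zero: "cinner x x = 0 \<longleftrightarrow> x = (0::'a::complex_hilbert)"
  by (simp add: cinner_self)

lemma cinner_zero_right: "cinner x 0 = (0::complex)" for x :: "'a::complex_hilbert"
  using cinner_diff_right[of x 0 0] by simp

lemma cinner_zero_left: "cinner 0 x = (0::complex)" for x :: "'a::complex_hilbert"
  using cinner_diff_left[of 0 0 x] by simp

lemma parallelogram:
  "(norm (x + y))\<^sup>2 + (norm (x - y))\<^sup>2 = 2 * (norm x)\<^sup>2 + 2 * (norm (y::'a::complex_hilbert))\<^sup>2"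
  unfolding norm_sq
  by (simp add: cinner_add_left cinner_add_right cinner_diff_left cinner_diff_right)

lemma projection_theorem:
  fixes x :: "'a::complex_hilbert"
  assumes S: "csubspace S" "closed S"
  obtains s where "s \<in> S" "\<And>y. y \<in> S \<Longrightarrow> cinner y (x - s) = 0"
proof -
  define D where "D = (\<lambda>s. (norm (x - s))\<^sup>2) ` S"
  define d where "d = Inf D"
  have ne: "D \<noteq> {}" using S by (auto simp: D_def csubspace_def)
  have bdd: "bdd_below D" by (rule bdd_belowI[of _ 0]) (auto simp: D_def)
  have low: "d \<le> (norm (x - s))\<^sup>2" if "s \<in> S" for s
    unfolding d_def by (rule cInf_lower[OF _ bdd]) (use that in \<open>auto simp: D_def\<close>)
  have "\<exists>s\<in>S. (norm (x - s))\<^sup>2 < d + 1 / real (Suc n)" for n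
    using cInf_lessD[OF ne, of "d + 1 / real (Suc n)"] by (auto simp: d_def D_def)
  then obtain s where s: "\<And>n. s n \<in> S" "\<And>n. (norm (x - s n))\<^sup>2 < d + 1 / real (Suc n)"
    by metis
  have close: "(norm (s m - s n))\<^sup>2 \<le> 2 / real (Suc m) + 2 / real (Suc n)" for m n
  proof -
    have "(1/2) *\<^sub>R (s m + s n) \<in> S"
      using S(1) s(1) by (intro csubspace_scaleR) (auto simp: csubspace_def)
    then have "d \<le> (norm (x - (1/2) *\<^sub>R (s m + s n)))\<^sup>2" by (rule low)
    also have "x - (1/2) *\<^sub>R (s m + s n) = (1/2) *\<^sub>R ((x - s m) + (x - s n))"
      by (simp add: algebra_simps flip: scaleR_add_left)
    finally have "4 * d \<le> (norm ((x - s m) + (x - s n)))\<^sup>2"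
      by (simp add: power_mult_distrib power2_eq_square)
    moreover have "(norm ((x - s m) + (x - s n)))\<^sup>2 + (norm (s n - s m))\<^sup>2
        = 2 * (norm (x - s m))\<^sup>2 + 2 * (norm (x - s n))\<^sup>2"
      using parallelogram[of "x - s m" "x - s n"] by (simp add: algebra_simps)
    ultimately show ?thesis using s(2)[of m] s(2)[of n] by (simp add: norm_minus_commute)
  qed
  have "Cauchy s"
  proof (rule CauchyI)
    fix e :: real assume e: "0 < e"
    then obtain N where N: "4 / e\<^sup>2 < real N" using reals_Archimedean2 by blast
    have "norm (s m - s n) < e" if "m \<ge> N" "n \<ge> N" for m n
    proof -
      have "0 < real N" using N e by (smt (verit) divide_pos_pos zero_less_power)
      then have "2 / real (Suc k) < 2 / real N" if "k \<ge> N" for k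
        using that by (intro divide_strict_left_mono) auto
      then have "(norm (s m - s n))\<^sup>2 < 4 / real N"
        using close[of m n] that by (smt (verit) add_divide_distrib)
      also have "\<dots> < e\<^sup>2" using N e \<open>0 < real N\<close> by (simp add: field_simps)
      finally show ?thesis using e by (simp add: power2_less_imp_less)
    qed
    then show "\<exists>M. \<forall>m\<ge>M. \<forall>n\<ge>M. norm (s m - s n) < e" by blast
  qed
  then obtain l where l: "s \<longlonglongrightarrow> l" using Cauchy_convergent convergent_def by blast
  have lS: "l \<in> S" using closed_sequentially[OF S(2) s(1) l] .
  have "(\<lambda>n. (norm (x - s n))\<^sup>2) \<longlonglongrightarrow> (norm (x - l))\<^sup>2"
    by (intro tendsto_intros l)
  moreover have "(\<lambda>n. d + 1 / real (Suc n)) \<longlonglongrightarrow> d + 0"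
    by (intro tendsto_intros LIMSEQ_Suc lim_1_over_n)
  ultimately have min: "(norm (x - l))\<^sup>2 \<le> d"
    using s(2) by (intro LIMSEQ_le[of _ "(norm (x - l))\<^sup>2" _ d]) (auto intro: less_imp_le)
  have "cinner y (x - l) = 0" if y: "y \<in> S" for y
  proof (cases "y = 0")
    case False
    define z where "z = x - l"
    define c where "c = cinner y z / complex_of_real ((norm y)\<^sup>2)"
    have "l + c *\<^sub>C y \<in> S" using S(1) lS y by (auto simp: csubspace_def)
    then have "d \<le> (norm (x - (l + c *\<^sub>C y)))\<^sup>2" by (rule low)
    then have "(norm z)\<^sup>2 \<le> (norm (z - c *\<^sub>C y))\<^sup>2"
      using min unfolding z_def diff_diff_eq by (rule order_trans[rotated])
    also have "\<dots> = Re (cinner z z - c * cinner z y - cnj c * cinner y z + cnj c * c * cinner y y)"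
      unfolding norm_sq
      by (simp add: cinner_diff_left cinner_diff_right cinner_scaleC_left cinner_scaleC_right
          algebra_simps)
    also have "cnj c * c * cinner y y = cnj c * cinner y z"
    proof -
      have "c * cinner y y = cinner y z" using False by (simp add: c_def cinner_self)
      then show ?thesis by (metis mult.assoc)
    qed
    also have "cinner z y = cnj (cinner y z)" by (rule cinner_commute)
    finally have "Re (c * cnj (cinner y z)) \<le> 0" by (simp add: norm_sq)
    moreover have "c * cnj (cinner y z) = complex_of_real ((cmod (cinner y z))\<^sup>2 / (norm y)\<^sup>2)"
      by (simp add: c_def flip: complex_norm_square of_real_power)
    ultimately have "(cmod (cinner y z))\<^sup>2 / (norm y)\<^sup>2 \<le> 0" by simp
    then show ?thesis using False
      by (simp add: z_def divide_le_0_iff)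
  qed (simp add: cinner_zero_left)
  with lS show thesis using that by blast
qed


section \<open>Projections\<close>

definition is_proj :: "('a::complex_hilbert \<Rightarrow> 'a) \<Rightarrow> bool" where
  "is_proj P \<longleftrightarrow> bounded_op P \<and> P \<circ> P = P \<and> (\<forall>x y. cinner (P x) y = cinner x (P y))"

lemma is_projI:
  assumes "clinear P" "P \<circ> P = P" "\<And>x y. cinner (P x) y = cinner x (P y)"
  shows "is_proj P"
proof -
  have "norm (P x) \<le> norm x" for x
  proof -
    have PP: "P (P x) = P x" using assms(2) by (metis comp_apply)
    have "cinner (x - P x) (P x) = 0"
      using assms(3)[of x "P x"] by (simp add: cinner_diff_left PP)
    moreover from this have "cinner (P x) (x - P x) = 0"
      by (metis cinner_commute complex_cnj_zero)
    moreover have "x = P x + (x - P x)" by simp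
    ultimately have "cinner x x = cinner (P x) (P x) + cinner (x - P x) (x - P x)"
      by (metis add.right_neutral add_0 cinner_add_left cinner_add_right)
    then have "(norm x)\<^sup>2 = (norm (P x))\<^sup>2 + (norm (x - P x))\<^sup>2"
      unfolding cinner_self by (metis of_real_add of_real_eq_iff)
    then show ?thesis by (simp add: power2_le_imp_le)
  qed
  moreover have "P (r *\<^sub>R x) = r *\<^sub>R P x" for r x
    using assms(1) by (metis clinear_def scaleC_of_real)
  ultimately show ?thesis using assms
    unfolding is_proj_def bounded_op_def clinear_def
    by (auto intro!: bounded_linear_intro[where K = 1])
qed

lemma is_proj_zero: "is_proj (\<lambda>_. 0 :: 'a::complex_hilbert)"
proof (rule is_projI)
  have "c *\<^sub>C (0::'a) = 0" for c using scaleC_add_right[of c "0::'a" 0] by simp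
  then show "clinear (\<lambda>_. 0 :: 'a)" by (simp add: clinear_def)
qed (auto simp: cinner_zero_left cinner_zero_right)

typedef (overloaded) ('a::complex_hilbert) proj = "{P :: 'a \<Rightarrow> 'a. is_proj P}"
  morphisms op Proj
  using is_proj_zero by blast

lemma is_proj_op: "is_proj (op P)"
  using op by auto

lemma op_op [simp]: "op P (op P x) = op P x"
  using is_proj_op[of P] by (metis comp_apply is_proj_def)

lemma clinear_op: "clinear (op P)"
  using is_proj_op[of P] by (simp add: is_proj_def bounded_op_def)

lemma cinner_op: "cinner (op P x) y = cinner x (op P y)"
  using is_proj_op[of P] by (simp add: is_proj_def)

lemma range_op: "x \<in> range (op P) \<longleftrightarrow> op P x = x"
  by (auto intro: range_eqI[OF sym])

lemma csubspace_range_op: "csubspace (range (op P))"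
  unfolding csubspace_def
proof (intro conjI ballI allI)
  have "op P (0 + 0) = op P 0 + op P 0" using clinear_op unfolding clinear_def by blast
  then show "0 \<in> range (op P)" by (metis add_cancel_right_right add_0 rangeI)
qed (use clinear_op[of P] in \<open>auto simp: range_op clinear_def\<close>)

lemma closed_range_op: "closed (range (op P))"
proof -
  have "continuous_on UNIV (op P)"
    using is_proj_op[of P] by (auto simp: is_proj_def bounded_op_def linear_continuous_on)
  then have "closed {x. op P x = x}" by (intro closed_Collect_eq continuous_on_id)
  then show ?thesis by (simp add: range_op[symmetric])
qed

lemma proj_eqI:
  assumes "range (op P) = range (op Q)" shows "P = Q"
proof -
  have "op P x = op Q x" for x
  proof -
    have *: "op Q (op P y) = op P y" "op P (op Q y) = op Q y" for y
      using assms range_op by blast+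
    have "cinner (op P x - op Q x) z = 0" if "op P z = z" for z
      using that * cinner_op[of P x z] cinner_op[of Q x z] by (metis cinner_diff_left diff_self)
    moreover have "op P (op P x - op Q x) = op P x - op Q x"
      using csubspace_diff[OF csubspace_range_op, of "op P x" P "op Q x"] assms
      by (metis rangeI range_op)
    ultimately have "op P x - op Q x = 0" using cinner_eq_zero by blast
    then show ?thesis by simp
  qed
  then have "op P = op Q" ..
  then show ?thesis by (simp add: op_inject)
qed

lemma ex_proj:
  fixes S :: "'a::complex_hilbert set"
  assumes S: "csubspace S" "closed S"
  obtains P where "range (op P) = S"
proof -
  have "\<exists>s. s \<in> S \<and> (\<forall>y\<in>S. cinner y (x - s) = 0)" for x
    by (rule projection_theorem[OF S, of x]) blast
  then obtain p where *: "\<And>x. p x \<in> S \<and> (\<forall>y\<in>S. cinner y (x - p x) = 0)" by metis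
  then have p: "\<And>x. p x \<in> S" "\<And>x y. y \<in> S \<Longrightarrow> cinner y (x - p x) = 0" by blast+
  have uniq: "s = p x" if "s \<in> S" "\<And>y. y \<in> S \<Longrightarrow> cinner y (x - s) = 0" for s x
  proof -
    have "s - p x \<in> S" using csubspace_diff[OF S(1) that(1) p(1)] .
    then have "cinner (s - p x) (x - p x) = 0" "cinner (s - p x) (x - s) = 0"
      using that(2) p(2) by blast+
    then have "cinner (s - p x) ((x - p x) - (x - s)) = 0"
      by (simp only: cinner_diff_right[of _ "x - p x" "x - s"]) simp
    then show ?thesis by (simp add: cinner_eq_zero)
  qed
  have fixd: "p s = s" if "s \<in> S" for s
    by (rule uniq[symmetric]) (use that in \<open>auto simp: cinner_zero_right\<close>)
  have "clinear p" unfolding clinear_def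
  proof (intro conjI allI)
    fix x y
    have "p x + p y = p (x + y)"
    proof (rule uniq)
      fix z assume z: "z \<in> S"
      have "x + y - (p x + p y) = (x - p x) + (y - p y)" by simp
      then show "cinner z (x + y - (p x + p y)) = 0"
        using p(2)[OF z] by (metis add.right_neutral cinner_add_right)
    qed (use S(1) p(1) in \<open>auto simp: csubspace_def\<close>)
    then show "p (x + y) = p x + p y" by simp
  next
    fix c x
    have "c *\<^sub>C p x = p (c *\<^sub>C x)"
    proof (rule uniq)
      fix z assume z: "z \<in> S"
      show "cinner z (c *\<^sub>C x - c *\<^sub>C p x) = 0"
        using p(2)[OF z, of x] by (simp add: cinner_diff_right cinner_scaleC_right)
    qed (use S(1) p(1) in \<open>auto simp: csubspace_def\<close>)
    then show "p (c *\<^sub>C x) = c *\<^sub>C p x" by simp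
  qed
  moreover have "p \<circ> p = p" using p(1) fixd by auto
  moreover have "cinner (p x) y = cinner x (p y)" for x y
  proof -
    have 1: "cinner (p x) y = cinner (p x) (p y)"
      using p(2)[OF p(1)[of x], of y] by (simp add: cinner_diff_right)
    have "cinner (p y) x = cinner (p y) (p x)"
      using p(2)[OF p(1)[of y], of x] by (simp add: cinner_diff_right)
    then have "cinner x (p y) = cinner (p x) (p y)" by (metis cinner_commute)
    with 1 show ?thesis by simp
  qed
  ultimately have "is_proj p" by (rule is_projI)
  then have "op (Proj p) = p" by (simp add: Proj_inverse)
  moreover have "range p = S" using p(1) fixd by (metis image_subsetI rangeI subsetI subset_antisym)
  ultimately show thesis using that by metis
qed

text \<open>Projections are ordered by inclusion of ranges; \<open>-P\<close> is the orthogonal complement \<open>1 - P\<close>.\<close>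

instantiation proj :: (complex_hilbert) "{complete_lattice, uminus}"
begin

definition less_eq_proj :: "'a proj \<Rightarrow> 'a proj \<Rightarrow> bool" where
  "less_eq_proj P Q \<longleftrightarrow> range (op P) \<subseteq> range (op Q)"

definition less_proj :: "'a proj \<Rightarrow> 'a proj \<Rightarrow> bool" where
  "less_proj P Q \<longleftrightarrow> P \<le> Q \<and> \<not> Q \<le> P"

definition Inf_proj :: "'a proj set \<Rightarrow> 'a proj" where
  "Inf_proj S = (THE P. range (op P) = (\<Inter>Q\<in>S. range (op Q)))"

definition Sup_proj :: "'a proj set \<Rightarrow> 'a proj" where
  "Sup_proj S = Inf {P. \<forall>Q\<in>S. Q \<le> P}"

definition inf_proj :: "'a proj \<Rightarrow> 'a proj \<Rightarrow> 'a proj" where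
  "inf_proj P Q = Inf {P, Q}"

definition sup_proj :: "'a proj \<Rightarrow> 'a proj \<Rightarrow> 'a proj" where
  "sup_proj P Q = Sup {P, Q}"

definition top_proj :: "'a proj" where
  "top_proj = Inf {}"

definition bot_proj :: "'a proj" where
  "bot_proj = Sup {}"

definition uminus_proj :: "'a proj \<Rightarrow> 'a proj" where
  "uminus_proj P = Proj (\<lambda>x. x - op P x)"

lemma range_Inf_proj: "range (op (Inf S)) = (\<Inter>Q\<in>S. range (op (Q :: 'a proj)))"
proof -
  have "csubspace (\<Inter>Q\<in>S. range (op (Q :: 'a proj)))"
    using csubspace_range_op[unfolded csubspace_def] unfolding csubspace_def Ball_def INT_iff by meson
  moreover have "closed (\<Inter>Q\<in>S. range (op (Q :: 'a proj)))"
    by (intro closed_INT ballI closed_range_op)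
  ultimately obtain P where P: "range (op P) = (\<Inter>Q\<in>S. range (op Q))" by (rule ex_proj)
  then have "Inf S = P" unfolding Inf_proj_def
    by (intro the_equality) (assumption, rule proj_eqI, simp only:)
  with P show ?thesis by simp
qed

instance
proof
  fix x y z :: "'a proj" and A :: "'a proj set"
  show "x \<sqinter> y \<le> x" "x \<sqinter> y \<le> y" "x \<le> y \<Longrightarrow> x \<le> z \<Longrightarrow> x \<le> y \<sqinter> z"
    by (auto simp: less_eq_proj_def inf_proj_def range_Inf_proj)
  show "x \<in> A \<Longrightarrow> \<Sqinter>A \<le> x" "(\<And>x. x \<in> A \<Longrightarrow> z \<le> x) \<Longrightarrow> z \<le> \<Sqinter>A"
    unfolding less_eq_proj_def range_Inf_proj by blast+
  show "x \<le> y \<Longrightarrow> y \<le> x \<Longrightarrow> x = y"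
    by (auto simp: less_eq_proj_def intro: proj_eqI)
qed (unfold less_proj_def less_eq_proj_def sup_proj_def Sup_proj_def range_Inf_proj
      top_proj_def bot_proj_def, blast+)

end

lemma op_uminus: "op (- P) x = x - op P x"
proof -
  have "is_proj (\<lambda>x. x - op P x)"
  proof (rule is_projI)
    have s: "c *\<^sub>C (y - z) = c *\<^sub>C y - c *\<^sub>C (z::'a)" for c y z
      using scaleC_add_right[of c "y - z" z] by (simp add: algebra_simps)
    show "clinear (\<lambda>x. x - op P x)"
      using clinear_op[of P] by (simp add: clinear_def s)
    have "op P (y - op P y) = 0" for y
    proof -
      have "op P ((y - op P y) + op P y) = op P (y - op P y) + op P (op P y)"
        using clinear_op[of P] unfolding clinear_def by blast
      then show ?thesis by simp
    qed
    then show "(\<lambda>x. x - op P x) \<circ> (\<lambda>x. x - op P x) = (\<lambda>x. x - op P x)" by auto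
  qed (auto simp: cinner_diff_left cinner_diff_right cinner_op)
  then show ?thesis by (simp add: uminus_proj_def Proj_inverse)
qed


section \<open>Logics and affiliated self-adjoint operators\<close>

definition proj_commutant :: "'a::complex_hilbert proj set \<Rightarrow> 'a proj set" where
  "proj_commutant S = {P. \<forall>Q\<in>S. op P \<circ> op Q = op Q \<circ> op P}"

definition is_logic :: "'a::complex_hilbert proj set \<Rightarrow> bool" where
  "is_logic Q \<longleftrightarrow> proj_commutant (proj_commutant Q) = Q"

definition commutant :: "('a::complex_hilbert \<Rightarrow> 'a) set \<Rightarrow> ('a \<Rightarrow> 'a) set" where
  "commutant S = {T. bounded_op T \<and> (\<forall>R\<in>S. T \<circ> R = R \<circ> T)}"

text \<open>Unbounded operators are partial functions.\<close>

type_synonym 'a lop = "'a \<rightharpoonup> 'a"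

text \<open>Density of the domain makes the \<open>z\<close> below unique; it is the value of the adjoint at \<open>y\<close>, and the
  last clause says that \<open>A\<close> equals its adjoint, including domains.\<close>

definition selfadjoint :: "'a::complex_hilbert lop \<Rightarrow> bool" where
  "selfadjoint A \<longleftrightarrow>
     csubspace (dom A) \<and> closure (dom A) = UNIV \<and>
     (\<forall>x\<in>dom A. \<forall>y\<in>dom A. the (A (x + y)) = the (A x) + the (A y)) \<and>
     (\<forall>c. \<forall>x\<in>dom A. the (A (c *\<^sub>C x)) = c *\<^sub>C the (A x)) \<and>
     (\<forall>y z. A y = Some z \<longleftrightarrow> (\<forall>x\<in>dom A. cinner y (the (A x)) = cinner z x))"

text \<open>\<open>A\<close> is affiliated with \<open>M\<close> if \<open>U\<^sup>* A U = A\<close> for all unitaries \<open>U\<close> in the commutant of \<open>M\<close>.\<close>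

definition affiliated :: "'a::complex_hilbert lop \<Rightarrow> ('a \<Rightarrow> 'a) set \<Rightarrow> bool" where
  "affiliated A M \<longleftrightarrow>
     (\<forall>U \<in> commutant M. unitary U \<longrightarrow> (\<lambda>x. map_option (inv U) (A (U x))) = A)"

definition spectral_family :: "(real \<Rightarrow> 'a::complex_hilbert proj) \<Rightarrow> bool" where
  "spectral_family E \<longleftrightarrow> mono E \<and>
     (\<forall>x r. ((\<lambda>s. op (E s) x) \<longlongrightarrow> op (E r) x) (at_right r)) \<and>
     (\<forall>x. ((\<lambda>s. op (E s) x) \<longlongrightarrow> 0) at_bot) \<and>
     (\<forall>x. ((\<lambda>s. op (E s) x) \<longlongrightarrow> x) at_top)"

text \<open>The measure \<open>d\<langle>E(\<lambda>)x, x\<rangle>\<close>\<close>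

definition spectral_measure :: "(real \<Rightarrow> 'a::complex_hilbert proj) \<Rightarrow> 'a \<Rightarrow> real measure" where
  "spectral_measure E x = interval_measure (\<lambda>s. Re (cinner x (op (E s) x)))"

text \<open>\<open>A = \<integral> \<lambda> dE(\<lambda>)\<close>, i.e. \<open>dom A = {x. \<integral> \<lambda>\<^sup>2 d\<langle>E(\<lambda>)x, x\<rangle> < \<infinity>}\<close> and \<open>\<langle>Ax, x\<rangle> = \<integral> \<lambda> d\<langle>E(\<lambda>)x, x\<rangle>\<close> there.\<close>

definition resolution_of_identity :: "(real \<Rightarrow> 'a::complex_hilbert proj) \<Rightarrow> 'a lop \<Rightarrow> bool" where
  "resolution_of_identity E A \<longleftrightarrow> spectral_family E \<and>
     dom A = {x. integrable (spectral_measure E x) (\<lambda>s. s\<^sup>2)} \<and>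
     (\<forall>x \<in> dom A. cinner x (the (A x)) = complex_of_real (\<integral>s. s \<partial>spectral_measure E x))"


section \<open>The real number in the model given by an operator\<close>

definition op_name :: "(rat \<Rightarrow> 'k V) \<Rightarrow> (real \<Rightarrow> 'a::complex_hilbert proj) \<Rightarrow> ('k, 'a proj) name" where
  "op_name \<rho> E = rat_fun \<rho> (\<lambda>r. E (of_rat r))"

text \<open>An index type large enough for the set of all reals of the model to be the domain of a
  name (see \<open>graph_interval_name\<close>); the universe can be made larger still by the choice of \<open>'k\<close>.\<close>

type_synonym ('a, 'k) index = "rat + (rat \<Rightarrow> 'a proj) + 'k"


section \<open>Size conditions\<close>

text \<open>The applications of \<open>mk\<close> in the definitions above are to small sets, so the graphs are the intended ones.\<close>

lemma graph_mk_countable: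
  fixes S :: "((('a::complex_hilbert, 'k) index, 'q) name \<times> 'q) set"
  assumes "countable S" shows "graph (mk S) = S"
  by (rule graph_mk[where e = "\<lambda>x. Inl (of_nat (to_nat_on S x))"])
    (use inj_on_to_nat_on[OF assms] in \<open>auto simp: inj_on_def\<close>)

lemma graph_nset:
  fixes S :: "(('a::complex_hilbert, 'k) index, 'q::top) name set"
  assumes "countable S" shows "graph (nset S) = (\<lambda>x. (x, top)) ` S"
  unfolding nset_def by (rule graph_mk_countable) (use assms in simp)

lemma ndom_check_ratset:
  fixes \<rho> :: "rat \<Rightarrow> ('a::complex_hilbert, 'k) index V"
  shows "ndom (check (ratset \<rho>) :: (('a, 'k) index, 'q::top) name) = range (\<lambda>r. check (\<rho> r))"
proof -
  have 1: "ndom (ratset \<rho>) = range \<rho>"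
    by (auto simp: ndom_def ratset_def graph_nset)
  show ?thesis
    unfolding check.simps[of "ratset _"] 1 unfolding ndom_def
    by (subst graph_mk_countable) (auto simp: image_image)
qed

lemma graph_rat_fun:
  fixes \<rho> :: "rat \<Rightarrow> ('a::complex_hilbert, 'k) index V"
  shows "graph (rat_fun \<rho> f) = range (\<lambda>t. (check (\<rho> t), f t))"
  unfolding rat_fun_def by (rule graph_mk_countable) simp

lemma universe_single_valued: "u \<in> universe Q \<Longrightarrow> single_valued (graph u)"
  by (auto elim: universe.cases)

lemma app_eq: "single_valued (graph u) \<Longrightarrow> (x, q) \<in> graph u \<longleftrightarrow> x \<in> ndom u \<and> app u x = q"
  unfolding ndom_def app_def single_valued_def by (metis (mono_tags, lifting) DomainE Domain.intros the_equality)

lemma name_eqI: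
  assumes "u \<in> universe Q" "v \<in> universe Q" "ndom u = ndom v" "\<And>x. x \<in> ndom u \<Longrightarrow> app u x = app v x"
  shows "u = v"
proof -
  have "p \<in> graph u \<longleftrightarrow> p \<in> graph v" for p
    using assms(3,4) app_eq[OF universe_single_valued[OF assms(1)], of "fst p" "snd p"]
      app_eq[OF universe_single_valued[OF assms(2)], of "fst p" "snd p"] by auto
  then show ?thesis using graph_inject by blast
qed

lemma graph_interval_name:
  fixes \<rho> :: "rat \<Rightarrow> ('a::complex_hilbert, 'k) index V" and Q :: "'a proj set"
  shows "graph (interval_name Q \<rho> a b) =
    (\<lambda>u. (u, lt_val (real_name \<rho> a) u \<sqinter> le_val u (real_name \<rho> b))) ` reals Q \<rho>"
  unfolding interval_name_def
proof (rule graph_mk[where e = "\<lambda>(u, _). Inr (Inl (\<lambda>r. app u (check (\<rho> r))))"])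
  have "u = v" if uv: "u \<in> reals Q \<rho>" "v \<in> reals Q \<rho>"
    "(\<lambda>r. app u (check (\<rho> r))) = (\<lambda>r. app v (check (\<rho> r)))" for u v
  proof (rule name_eqI[of _ Q])
    fix x assume "x \<in> ndom u"
    then obtain r where "x = check (\<rho> r)" using uv(1) by (auto simp: reals_def ndom_check_ratset)
    then show "app u x = app v x" using uv(3) by metis
  qed (use uv in \<open>auto simp: reals_def\<close>)
  then show "inj_on (\<lambda>(u, _). Inr (Inl (\<lambda>r. app u (check (\<rho> r)))))
    ((\<lambda>u. (u, lt_val (real_name \<rho> a) u \<sqinter> le_val u (real_name \<rho> b))) ` reals Q \<rho>)"
    by (auto simp: inj_on_def)
qed

end

theory Submission
  imports Defs "HOL-Probability.Distribution_Functions"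
begin

text \<open>
  The Sasaki implication \<open>P \<rightarrow>\<^sub>S R\<close> has range \<open>{x. P x \<in> range R}\<close>, so for two names of reals the value of
  \<open>u = v\<close> has range \<open>{x. \<forall>r. u\<^sub>r x = v\<^sub>r x}\<close>, without any commutativity.  If \<open>U c\<close> denotes the infimum of \<open>u\<^sub>r\<close> over the
  rationals \<open>r > c\<close>, the value of \<open>a < u \<and> u \<le> b\<close> is \<open>- U a \<sqinter> U b\<close>.  On vectors where \<open>u\<^sub>r\<close> and \<open>E r\<close> agree for all
  \<open>r\<close>, right continuity gives \<open>U c x = E c x\<close>; hence every term of the supremum defining the membership is below
  \<open>- E a \<sqinter> E b\<close>, and the term for \<open>E\<close> itself attains it.  That term occurs only if all \<open>E r\<close> lie in the logic:
  for a projection \<open>P\<close> in the commutant the reflection \<open>1 - 2 P\<close> commutes with the operator, and a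
  power-growth comparison of the operator on the two sides of \<open>r\<close> shows that it leaves the range of \<open>E r\<close> invariant.
\<close>

section \<open>The lattice of projections\<close>

lemma op_add: "op P (x + y) = op P x + op P y"
  using clinear_op unfolding clinear_def by blast

lemma op_scaleC: "op P (c *\<^sub>C x) = c *\<^sub>C op P x"
  using clinear_op unfolding clinear_def by blast

lemma op_diff: "op P (x - y) = op P x - op P y"
  using op_add[of P "x - y" y] by (simp add: algebra_simps)

lemma op_0 [simp]: "op P 0 = 0"
  using op_diff[of P 0 0] by simp

lemma bounded_linear_op: "bounded_linear (op P)"
  using is_proj_op[of P] by (simp add: is_proj_def bounded_op_def)

lemma cinner_op_self: "cinner x (op P x) = complex_of_real ((norm (op P x))\<^sup>2)"
  by (metis cinner_op cinner_self op_op)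

lemma norm_op_Pythagoras: "(norm x)\<^sup>2 = (norm (op P x))\<^sup>2 + (norm (x - op P x))\<^sup>2"
proof -
  have "cinner x x = cinner (op P x) (op P x) + cinner (x - op P x) (x - op P x)"
    by (simp add: cinner_diff_left cinner_diff_right cinner_op)
  then show ?thesis
    unfolding cinner_self by (metis of_real_add of_real_eq_iff)
qed

lemma norm_op_le: "norm (op P x) \<le> norm x"
  using norm_op_Pythagoras[of x P] by (simp add: power2_le_imp_le)

lemma le_proj_iff: "P \<le> R \<longleftrightarrow> (\<forall>x. op P x = x \<longrightarrow> op R x = x)"
  unfolding less_eq_proj_def subset_iff range_op ..

lemma proj_eqI': "(\<And>x. op P x = x \<longleftrightarrow> op R x = x) \<Longrightarrow> P = R"
  by (metis le_proj_iff order_antisym)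

lemma op_INF: "op (\<Sqinter>i\<in>I. P i) x = x \<longleftrightarrow> (\<forall>i\<in>I. op (P i) x = x)"
  unfolding range_op[symmetric] range_Inf_proj by auto

lemma op_inf: "op (P \<sqinter> R) x = x \<longleftrightarrow> op P x = x \<and> op R x = x"
  unfolding range_op[symmetric] inf_proj_def range_Inf_proj by auto

lemma op_top [simp]: "op top x = x"
  unfolding range_op[symmetric] top_proj_def range_Inf_proj by auto

lemma op_uminus_fixed: "op (- P) x = x \<longleftrightarrow> op P x = 0"
  by (simp add: op_uminus)

lemma op_bot [simp]: "op bot x = 0"
proof -
  have "bot \<le> - (top :: 'a proj)" by simp
  then have "op (- top) (op bot x) = op bot x" unfolding le_proj_iff by simp
  then show ?thesis by (simp add: op_uminus)
qed

lemma uminus_bot_proj [simp]: "- bot = (top :: 'a::complex_hilbert proj)"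
  by (rule proj_eqI') (simp add: op_uminus)

lemma uminus_uminus_proj [simp]: "- (- P) = (P :: 'a::complex_hilbert proj)"
  by (rule proj_eqI') (simp add: op_uminus)

lemma uminus_proj_mono: "P \<le> R \<Longrightarrow> - R \<le> - (P :: 'a::complex_hilbert proj)"
  unfolding le_proj_iff op_uminus_fixed
proof (intro allI impI)
  fix x assume *: "\<forall>x. op P x = x \<longrightarrow> op R x = x" and x: "op R x = 0"
  have "cinner (op P x) (op P x) = cinner (op R (op P x)) x"
    using * by (simp add: cinner_op)
  also have "\<dots> = 0" using x by (simp only: cinner_op cinner_zero_right)
  finally show "op P x = 0" by (simp add: cinner_eq_zero)
qed

text \<open>The second equation is the first one for complements: \<open>- R \<le> - P\<close> gives
  \<open>P (1 - R) = 0\<close>.\<close>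

lemma op_absorb:
  assumes "P \<le> R" shows "op R (op P x) = op P x" "op P (op R x) = op P x"
proof -
  show *: "op R (op P x) = op P x" for x using assms by (simp add: le_proj_iff)
  have "op (- P) (op (- R) x) = op (- R) x"
    using uminus_proj_mono[OF assms] by (simp add: le_proj_iff)
  then show "op P (op R x) = op P x" by (simp add: op_uminus op_diff)
qed

lemma uminus_INF_proj: "- (\<Sqinter>i\<in>I. P i) = (\<Squnion>i\<in>I. - P i :: 'a::complex_hilbert proj)"
proof (rule antisym)
  have "- (\<Squnion>i\<in>I. - P i) \<le> (\<Sqinter>i\<in>I. P i)"
    by (rule INF_greatest) (metis SUP_upper uminus_proj_mono uminus_uminus_proj)
  from uminus_proj_mono[OF this] show "- (\<Sqinter>i\<in>I. P i) \<le> (\<Squnion>i\<in>I. - P i)" by simp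
qed (auto intro!: SUP_least uminus_proj_mono INF_lower)

text \<open>The range of a supremum is a closed span and hard to test pointwise; by de Morgan its
  kernel is simply an intersection of kernels.\<close>

lemma op_SUP_zero: "op (\<Squnion>i\<in>I. P i) x = 0 \<longleftrightarrow> (\<forall>i\<in>I. op (P i) x = 0)"
proof -
  have "- (\<Squnion>i\<in>I. P i) = (\<Sqinter>i\<in>I. - P i)"
    using arg_cong[OF uminus_INF_proj[of "\<lambda>i. - P i" I], of uminus] by simp
  then have "op (- (\<Squnion>i\<in>I. P i)) x = x \<longleftrightarrow> (\<forall>i\<in>I. op (- P i) x = x)"
    using op_INF[of "\<lambda>i. - P i" I x] by simp
  then show ?thesis unfolding op_uminus_fixed .
qed

lemma SUP_proj_eq_top:
  "(\<Squnion>i\<in>I. P i) = top \<longleftrightarrow> (\<forall>x. (\<forall>i\<in>I. op (P i) x = 0) \<longrightarrow> x = 0)"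
proof
  assume *: "\<forall>x. (\<forall>i\<in>I. op (P i) x = 0) \<longrightarrow> x = 0"
  have "- (\<Squnion>i\<in>I. P i) = bot"
    using * by (intro proj_eqI') (auto simp: op_uminus op_SUP_zero)
  from arg_cong[OF this, of uminus] show "(\<Squnion>i\<in>I. P i) = top" by simp
next
  assume *: "(\<Squnion>i\<in>I. P i) = top"
  show "\<forall>x. (\<forall>i\<in>I. op (P i) x = 0) \<longrightarrow> x = 0"
    unfolding op_SUP_zero[symmetric] * by simp
qed

section \<open>The Sasaki implication read on vectors\<close>

text \<open>Split \<open>x\<close> as \<open>P x + (x - P x)\<close>. The second summand lies in the
  range of \<open>- P\<close>, and the first in that of \<open>P \<sqinter> R\<close> when the
  right-hand side holds. Conversely, the right-hand side cuts out a closed subspace that contains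
  both ranges.\<close>

lemma op_sasaki: "op (P \<rightarrow>\<^sub>S R) x = x \<longleftrightarrow> op R (op P x) = op P x"
proof -
  define S where "S = {x. op R (op P x) = op P x}"
  have "csubspace S"
    by (auto simp: S_def csubspace_def op_add op_scaleC)
  moreover have "closed S"
    unfolding S_def
    by (intro closed_Collect_eq linear_continuous_on bounded_linear_op
        bounded_linear_compose[OF bounded_linear_op bounded_linear_op])
  \<comment> \<open>A supremum can be compared only with projections, so \<open>S\<close> is turned
    into the range of one.\<close>
  ultimately obtain T where T: "range (op T) = S" by (rule ex_proj)
  then have T': "op T x = x \<longleftrightarrow> op R (op P x) = op P x" for x
    unfolding range_op[symmetric] S_def by simp
  have "(P \<rightarrow>\<^sub>S R) \<le> T"
    unfolding sasaki_def by (intro sup_least) (auto simp: le_proj_iff T' op_inf op_uminus_fixed)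
  moreover have "op (P \<rightarrow>\<^sub>S R) x = x" if x: "op R (op P x) = op P x"
  proof -
    have "op (P \<rightarrow>\<^sub>S R) (op P x) = op P x"
      using sup_ge2[of "P \<sqinter> R" "- P"] x by (auto simp: sasaki_def le_proj_iff op_inf)
    moreover have "op (P \<rightarrow>\<^sub>S R) (x - op P x) = x - op P x"
      using sup_ge1[of "- P" "P \<sqinter> R"]
      unfolding sasaki_def le_proj_iff op_uminus_fixed by (simp add: op_diff[of P])
    ultimately show ?thesis by (simp add: op_diff)
  qed
  ultimately show ?thesis using T' by (auto simp: le_proj_iff)
qed

lemma sasaki_eq_top: "P \<rightarrow>\<^sub>S R = top \<longleftrightarrow> P \<le> (R :: 'a::complex_hilbert proj)"
proof
  assume "P \<rightarrow>\<^sub>S R = top"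
  then have "op R (op P x) = op P x" for x by (simp flip: op_sasaki)
  then show "P \<le> R" by (metis le_proj_iff)
next
  assume "P \<le> R"
  then show "P \<rightarrow>\<^sub>S R = top" by (intro proj_eqI') (simp add: op_sasaki le_proj_iff)
qed

lemma iff_eq_top: "iff P R = top \<longleftrightarrow> P = (R :: 'a::complex_hilbert proj)"
  unfolding iff_def inf_eq_top_iff sasaki_eq_top by auto

lemma sasaki_simps [simp]:
  "top \<rightarrow>\<^sub>S P = P" "P \<rightarrow>\<^sub>S top = top" "bot \<rightarrow>\<^sub>S P = top" "P \<rightarrow>\<^sub>S bot = - P"
  for P :: "'a::complex_hilbert proj"
  by (rule proj_eqI'; auto simp: op_sasaki op_uminus)+

text \<open>The two implications give \<open>R P x = P x\<close> and \<open>P R x = R x\<close>.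
  Then the inner product of \<open>P x\<close> and \<open>R x\<close> equals the squared norm of
  each, so their difference has norm 0.\<close>

lemma op_biconditional:
  "op ((P \<rightarrow>\<^sub>S R) \<sqinter> (R \<rightarrow>\<^sub>S P)) x = x \<longleftrightarrow> op P x = op R x"
proof
  assume "op ((P \<rightarrow>\<^sub>S R) \<sqinter> (R \<rightarrow>\<^sub>S P)) x = x"
  then have 1: "op R (op P x) = op P x" "op P (op R x) = op R x" by (auto simp: op_inf op_sasaki)
  have 2: "cinner (op P x) (op R x) = cinner (op P x) (op P x)"
    if "op R (op P x) = op P x" for P R :: "'a proj"
    using that by (metis cinner_op op_op)
  have "cinner (op P x - op R x) (op P x - op R x) = 0"
    using 2[OF 1(1)] 2[OF 1(2)] by (simp add: cinner_diff_left cinner_diff_right) 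
  then show "op P x = op R x" by (simp add: cinner_eq_zero)
next
  assume *: "op P x = op R x"
  then have "op R (op P x) = op P x" "op P (op R x) = op R x"
    using op_op[of R x] op_op[of P x] by simp_all
  then show "op ((P \<rightarrow>\<^sub>S R) \<sqinter> (R \<rightarrow>\<^sub>S P)) x = x" by (simp add: op_inf op_sasaki)
qed

section \<open>Canonical names\<close>

text \<open>Choosing preimages injects such an image back into the index type, so it is small enough
  for \<open>mk\<close>.\<close>

lemma graph_mk_image:
  fixes h :: "'k \<Rightarrow> ('k, 'q) name \<times> 'q"
  shows "graph (mk (h ` K)) = h ` K"
  by (rule graph_mk[OF inj_on_inv_into[OF order_refl]])

text \<open>Makes smallness automatic for \<open>check\<close>: a graph never has more elements than
  there are indices, so no countability has to be shown.\<close>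

lemma graph_small:
  fixes u :: "('k, 'q) name"
  obtains h :: "'k \<Rightarrow> ('k, 'q) name \<times> 'q" and K where "graph u = h ` K"
proof -
  obtain f where u: "u = abs_name (Node f)" by (rule ex_abs)
  have "ran f = (the \<circ> f) ` dom f" by (force simp: ran_def dom_def image_iff)
  then have "graph u = ((\<lambda>(t, q). (abs_name t, q)) \<circ> (the \<circ> f)) ` dom f"
    unfolding u graph_abs by (simp only: image_comp)
  then show thesis by (rule that)
qed

lemma graph_check: "graph (check x :: ('k, 'q::top) name) = (\<lambda>y. (check y, top)) ` ndom x"
proof -
  obtain h and K :: "'k set" where "graph x = h ` K" by (rule graph_small)
  then have "ndom x = (fst \<circ> h) ` K" by (simp add: ndom_def Domain_fst image_comp)
  then show ?thesis
    unfolding check.simps[of x] by (simp only: image_comp graph_mk_image)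
qed

lemma ndom_check: "ndom (check x) = check ` ndom x"
  by (auto simp: ndom_def[of "check x"] graph_check)

lemma single_valued_check: "single_valued (graph (check x))"
  by (auto simp: single_valued_def graph_check)

lemma app_check: "c \<in> ndom (check x) \<Longrightarrow> app (check x) c = top"
  using app_eq[OF single_valued_check, of c top x] by (auto simp: ndom_check graph_check)

lemma V_eq_iff: "x = y \<longleftrightarrow> ndom x = ndom (y :: 'k V)"
  by (auto simp: ndom_def simp flip: graph_inject)

lemma inj_check: "inj (check :: 'k V \<Rightarrow> ('k, 'q::top) name)"
proof -
  let ?c = "check :: 'k V \<Rightarrow> ('k, 'q) name"
  have "\<forall>y. ?c x = ?c y \<longrightarrow> x = y" for x
  proof (induction x rule: name_induct)
    case (1 x)
    show ?case
    proof (intro allI impI)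
      fix y assume "?c x = ?c y"
      then have *: "?c ` ndom x = ?c ` ndom y" by (simp flip: ndom_check)
      have "z \<in> ndom y" if z: "z \<in> ndom x" for z
      proof -
        obtain z' where z': "z' \<in> ndom y" "?c z = ?c z'" using * z by blast
        then show ?thesis using 1[OF z] by simp
      qed
      moreover have "z \<in> ndom x" if z: "z \<in> ndom y" for z
      proof -
        obtain z' where z': "z' \<in> ndom x" "?c z' = ?c z" using * z by (metis imageE imageI)
        then show ?thesis using 1[OF z'(1)] by simp
      qed
      ultimately show "x = y" unfolding V_eq_iff by blast
    qed
  qed
  then show ?thesis by (simp add: inj_def)
qed

section \<open>Equality and membership of canonical names\<close>

lemma eqv_sym: "eqv u v = eqv v u"
  unfolding eqv_mem[of u v] eqv_mem[of v u] by (rule inf_commute)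

text \<open>When equality with \<open>x\<close> is two-valued on the members of \<open>v\<close>,
  the supremum defining membership has at most one nonzero term.\<close>

lemma mem_eqI:
  assumes "\<And>y. y \<in> ndom v \<Longrightarrow> eqv x y = (if x = y then top else bot)"
  shows "mem x v = (if x \<in> ndom v then app v x else bot)"
proof (cases "x \<in> ndom v")
  case True
  show ?thesis unfolding mem_def using True assms
    by (auto intro!: antisym SUP_least SUP_upper2[OF True])
next
  case False
  then show ?thesis unfolding mem_def using assms by (auto intro!: antisym SUP_least)
qed

lemma all_in_check: "all_in (check x) \<phi> = (\<Sqinter>z\<in>ndom x. \<phi> (check z :: ('k, 'a::complex_hilbert proj) name))"
  by (simp add: all_in_def app_check ndom_check image_image)

lemma ex_in_check: "ex_in (check x) \<phi> = (\<Squnion>z\<in>ndom x. \<phi> (check z :: ('k, 'a::complex_hilbert proj) name))"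
  by (simp add: ex_in_def app_check ndom_check image_image)

lemma INF_indicator: "(\<Sqinter>z\<in>A. if z \<in> B then top else bot) = (if A \<subseteq> B then top else bot :: 'q::complete_lattice)"
proof (cases "A \<subseteq> B")
  case False
  then obtain z where "z \<in> A" "z \<notin> B" by blast
  then have "(\<Sqinter>z\<in>A. if z \<in> B then top else bot) \<le> (bot :: 'q)" by (intro INF_lower2[of z]) auto
  with False show ?thesis by (simp only: if_False bot_unique)
qed (auto intro!: antisym INF_greatest)

lemma eqv_check:
  "eqv (check x) (check y) = (if x = y then top else bot :: 'a::complex_hilbert proj)"
proof (induction x arbitrary: y rule: name_induct)
  case (1 x)
  let ?c = "check :: 'b V \<Rightarrow> ('b, 'a proj) name"
  have 2: "mem (?c z) (?c y) = (if z \<in> ndom y then top else bot)" if "z \<in> ndom x" for z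
    by (subst mem_eqI) (use that 1 in \<open>auto simp: ndom_check inj_eq[OF inj_check] app_check\<close>)
  \<comment> \<open>Here the members of \<open>x\<close> stand in the second argument of
    \<open>eqv\<close>; symmetry brings them to the first, where the induction hypothesis
    applies.\<close>
  have 3: "mem (?c z) (?c x) = (if z \<in> ndom x then top else bot)" for z
    by (subst mem_eqI)
      (use 1 in \<open>auto simp: ndom_check inj_eq[OF inj_check] app_check eqv_sym[of "?c z"]\<close>)
  have "eqv (?c x) (?c y) =
      (\<Sqinter>z\<in>ndom x. if z \<in> ndom y then top else bot) \<sqinter> (\<Sqinter>z\<in>ndom y. if z \<in> ndom x then top else bot)"
    unfolding eqv_mem all_in_def[symmetric] all_in_check 3 by (simp add: 2 cong: INF_cong)
  then show ?case
    unfolding INF_indicator by (auto simp: V_eq_iff)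
qed

lemma mem_check:
  "mem (check x) (check y) = (if x \<in> ndom y then top else bot :: 'a::complex_hilbert proj)"
  by (subst mem_eqI) (auto simp: eqv_check ndom_check inj_eq[OF inj_check] app_check)

lemma subset_val_check:
  "subset_val (check x) (check y) = (if ndom x \<subseteq> ndom y then top else bot :: 'a::complex_hilbert proj)"
  unfolding subset_val_def all_in_check mem_check by (rule INF_indicator)

lemma check_in_universe: "top \<in> Q \<Longrightarrow> check x \<in> universe Q"
proof (induction x rule: name_induct)
  case (1 x)
  then show ?case
    by (intro universe.intros single_valued_check) (auto simp: ndom_check app_check)
qed

lemma ndom_nset:
  fixes S :: "(('a::complex_hilbert, 'k) index, 'q::top) name set"
  assumes "countable S" shows "ndom (nset S) = S"
  using graph_nset[OF assms] by (auto simp: ndom_def)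

lemma check_nset:
  fixes S :: "('a::complex_hilbert, 'k) index V set"
  assumes "countable S" shows "check (nset S) = nset (check ` S)"
  unfolding check.simps[of "nset S"] ndom_nset[OF assms] by (simp add: nset_def image_image)

lemma check_kpair:
  fixes x y :: "('a::complex_hilbert, 'k) index V"
  shows "check (kpair x y) = kpair (check x) (check y)"
  by (simp add: kpair_def check_nset)

lemma kpair_inject:
  fixes x y :: "('a::complex_hilbert, 'k) index V"
  shows "kpair x y = kpair x' y' \<longleftrightarrow> x = x' \<and> y = y'"
proof -
  have nset: "nset S = nset T \<longleftrightarrow> S = T" if "countable S" "countable T"
    for S T :: "('a, 'k) index V set"
    using that by (metis ndom_nset)
  show ?thesis
    by (auto simp: kpair_def nset doubleton_eq_iff)
qed

lemma less_val_check:
  fixes \<rho> :: "rat \<Rightarrow> ('a::complex_hilbert, 'k) index V"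
  assumes "inj \<rho>"
  shows "less_val \<rho> (check (\<rho> r)) (check (\<rho> s)) = (if r < s then top else bot :: 'a proj)"
proof -
  \<comment> \<open>Written as an image of a set of pairs of rationals, the relation is visibly
    countable, as \<open>ndom_nset\<close> requires.\<close>
  let ?S = "(\<lambda>(r, s). kpair (\<rho> r) (\<rho> s)) ` {(r, s). r < s}"
  have S: "{kpair (\<rho> r) (\<rho> s) | r s. r < s} = ?S" by auto
  have "ndom (ratless \<rho>) = ?S"
    unfolding ratless_def S by (intro ndom_nset) auto
  then have "kpair (\<rho> r) (\<rho> s) \<in> ndom (ratless \<rho>) \<longleftrightarrow> r < s"
    by (auto simp: kpair_inject inj_eq[OF assms])
  then show ?thesis
    unfolding less_val_def by (simp add: mem_check flip: check_kpair)
qed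

section \<open>Names of reals\<close>

abbreviation at_rat :: "(rat \<Rightarrow> 'k V) \<Rightarrow> ('k, 'q::top) name \<Rightarrow> rat \<Rightarrow> 'q" where
  "at_rat \<rho> u r \<equiv> app u (check (\<rho> r))"

lemma at_rat_rat_fun:
  fixes \<rho> :: "rat \<Rightarrow> ('a::complex_hilbert, 'k) index V"
  assumes "inj \<rho>" shows "at_rat \<rho> (rat_fun \<rho> f) r = f r"
proof -
  have "single_valued (graph (rat_fun \<rho> f))"
    using assms by (auto simp: single_valued_def graph_rat_fun inj_eq[OF inj_check] inj_eq)
  from app_eq[OF this, of "check (\<rho> r)" "f r"] show ?thesis by (auto simp: graph_rat_fun)
qed

lemma ndom_rat_fun:
  fixes \<rho> :: "rat \<Rightarrow> ('a::complex_hilbert, 'k) index V"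
  shows "ndom (rat_fun \<rho> f) = ndom (check (ratset \<rho>))"
  by (auto simp: ndom_def[of "rat_fun _ _"] graph_rat_fun ndom_check_ratset)

lemma mem_rat_domain:
  fixes \<rho> :: "rat \<Rightarrow> ('a::complex_hilbert, 'k) index V" and u :: "(('a, 'k) index, 'a proj) name"
  assumes "ndom u = ndom (check (ratset \<rho>))"
  shows "mem (check (\<rho> r)) u = at_rat \<rho> u r"
  by (subst mem_eqI) (auto simp: assms ndom_check_ratset eqv_check inj_eq[OF inj_check])

text \<open>As \<open>u \<le> v\<close> stands for \<open>v \<subseteq> u\<close>, the values of
  \<open>v\<close> are the premises of the Sasaki implications and those of \<open>u\<close> the
  conclusions.\<close>

lemma op_le_val:
  fixes \<rho> :: "rat \<Rightarrow> ('a::complex_hilbert, 'k) index V" and u v :: "(('a, 'k) index, 'a proj) name"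
  assumes "ndom u = ndom (check (ratset \<rho>))" "ndom v = ndom (check (ratset \<rho>))"
  shows "op (le_val u v) x = x \<longleftrightarrow>
    (\<forall>r. op (at_rat \<rho> u r) (op (at_rat \<rho> v r) x) = op (at_rat \<rho> v r) x)"
  by (simp add: le_val_def subset_val_def all_in_def assms(2) ndom_check_ratset op_INF op_sasaki
      mem_rat_domain[OF assms(1)])

text \<open>The two inclusions are regrouped, rational by rational, into biconditionals.\<close>

lemma op_eqv:
  fixes \<rho> :: "rat \<Rightarrow> ('a::complex_hilbert, 'k) index V" and u v :: "(('a, 'k) index, 'a proj) name"
  assumes "ndom u = ndom (check (ratset \<rho>))" "ndom v = ndom (check (ratset \<rho>))"
  shows "op (eqv u v) x = x \<longleftrightarrow> (\<forall>r. op (at_rat \<rho> u r) x = op (at_rat \<rho> v r) x)"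
proof -
  have "eqv u v = le_val v u \<sqinter> le_val u v"
    by (simp add: eqv_mem le_val_def subset_val_def all_in_def)
  then have "op (eqv u v) x = x \<longleftrightarrow>
      (\<forall>r. op ((at_rat \<rho> u r \<rightarrow>\<^sub>S at_rat \<rho> v r) \<sqinter> (at_rat \<rho> v r \<rightarrow>\<^sub>S at_rat \<rho> u r)) x = x)"
    by (auto simp: op_inf op_le_val[OF assms] op_le_val[OF assms(2,1)] op_sasaki)
  then show ?thesis unfolding op_biconditional .
qed

text \<open>These are the conditions on a resolution of the identity indexed by the rationals:
  supremum 1, infimum 0 (stated through complements) and right continuity, which implies
  monotonicity. As the order of canonical rationals is two-valued, the inner quantifier becomes an
  infimum over \<open>s > r\<close>.\<close>

lemma real_val_eq_top:
  fixes \<rho> :: "rat \<Rightarrow> ('a::complex_hilbert, 'k) index V" and u :: "(('a, 'k) index, 'a proj) name"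
  assumes "inj \<rho>" and u: "ndom u = ndom (check (ratset \<rho>))"
  shows "real_val \<rho> u = top \<longleftrightarrow>
    (\<Squnion>r. at_rat \<rho> u r) = top \<and> (\<Squnion>r. - at_rat \<rho> u r) = top \<and>
    (\<forall>r. at_rat \<rho> u r = (\<Sqinter>s\<in>{r<..}. at_rat \<rho> u s))"
proof -
  have rats: "ndom (ratset \<rho>) = range \<rho>"
    unfolding ratset_def by (rule ndom_nset) simp
  have "all_in u (\<lambda>y. mem y (check (ratset \<rho>))) = top"
    by (simp add: all_in_def u ndom_check_ratset mem_check rats)
  moreover have "(\<Sqinter>s. less_val \<rho> (check (\<rho> r)) (check (\<rho> s)) \<rightarrow>\<^sub>S at_rat \<rho> u s) =
      (\<Sqinter>s\<in>{r<..}. at_rat \<rho> u s)" for r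
    by (rule proj_eqI') (auto simp: op_INF less_val_check[OF assms(1)])
  ultimately show ?thesis
    by (simp add: real_val_def all_in_check ex_in_check rats mem_rat_domain[OF u] image_image
        iff_eq_top)
qed

lemma at_rat_real_name:
  fixes \<rho> :: "rat \<Rightarrow> ('a::complex_hilbert, 'k) index V"
  assumes "inj \<rho>"
  shows "at_rat \<rho> (real_name \<rho> a) t = (if a \<le> of_rat t then top else bot :: 'a proj)"
proof -
  have "ndom (cut \<rho> c) = \<rho> ` {r. c \<le> of_rat r}" for c
    unfolding cut_def by (rule ndom_nset) simp
  moreover have "{r. of_rat t \<le> (of_rat r :: real)} \<subseteq> {r. a \<le> of_rat r} \<longleftrightarrow> a \<le> of_rat t"
    using order_trans by auto
  ultimately show ?thesis
    by (simp add: real_name_def at_rat_rat_fun[OF assms] le_val_def subset_val_check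
        inj_image_subset_iff[OF assms])
qed

text \<open>The right-continuous extension of the rational family to real arguments, as the
  endpoints of an interval may be irrational; the strict inequality makes it a limit from the
  right.\<close>

definition upper_proj :: "(rat \<Rightarrow> 'k V) \<Rightarrow> ('k, 'q::complete_lattice) name \<Rightarrow> real \<Rightarrow> 'q" where
  "upper_proj \<rho> u c = (\<Sqinter>r\<in>{r. c < of_rat r}. at_rat \<rho> u r)"

text \<open>The values at all \<open>r \<ge> b\<close> fix \<open>x\<close> iff their right limit at
  \<open>b\<close> does. At the other end, \<open>a \<le> u\<close> says that the values below
  \<open>a\<close> kill \<open>x\<close>; for such \<open>x\<close> the vector \<open>U a x\<close>
  lies in the range of the value \<open>Eq\<close> of \<open>a = u\<close>, so
  \<open>Eq x = 0\<close> forces \<open>U a x = 0\<close>.\<close>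

lemma op_interval_value:
  fixes \<rho> :: "rat \<Rightarrow> ('a::complex_hilbert, 'k) index V" and u :: "(('a, 'k) index, 'a proj) name"
  assumes \<rho>: "inj \<rho>" and u: "u \<in> reals Q \<rho>"
  shows "op (lt_val (real_name \<rho> a) u \<sqinter> le_val u (real_name \<rho> b)) x = x \<longleftrightarrow>
    op (upper_proj \<rho> u a) x = 0 \<and> op (upper_proj \<rho> u b) x = x"
proof -
  let ?u = "at_rat \<rho> u" and ?U = "upper_proj \<rho> u"
  have dom: "ndom u = ndom (check (ratset \<rho>))" using u by (simp add: reals_def)
  have domr: "ndom (real_name \<rho> c :: (('a, 'k) index, 'a proj) name) = ndom (check (ratset \<rho>))" for c
    unfolding real_name_def by (rule ndom_rat_fun)
  have "real_val \<rho> u = top" using u by (simp add: reals_def)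
  then have cont: "?u r = (\<Sqinter>s\<in>{r<..}. ?u s)" for r
    unfolding real_val_eq_top[OF \<rho> dom] by blast
  \<comment> \<open>Right continuity admits the boundary case \<open>c = r\<close> here; the
    opposite comparison \<open>le_U\<close> is stated for \<open>r < c\<close>.\<close>
  have U_le: "?U c \<le> ?u r" if "c \<le> of_rat r" for c r
    unfolding cont[of r] upper_proj_def
  proof (rule INF_superset_mono)
    show "{r<..} \<subseteq> {s. c < of_rat s}"
    proof
      fix s assume "s \<in> {r<..}"
      then have "real_of_rat r < of_rat s" by (simp add: of_rat_less)
      with that show "s \<in> {s. c < of_rat s}" by simp
    qed
  qed simp
  have le_U: "?u r \<le> ?U c" if "of_rat r < c" for c r
    unfolding cont[of r] upper_proj_def
  proof (rule INF_superset_mono)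
    show "{s. c < of_rat s} \<subseteq> {r<..}"
    proof
      fix s assume "s \<in> {s. c < of_rat s}"
      with that have "real_of_rat r < of_rat s" by simp
      then show "s \<in> {r<..}" by (simp add: of_rat_less)
    qed
  qed simp
  define Eq where "Eq = eqv (real_name \<rho> a) u"
  have Eq: "op Eq y = y \<longleftrightarrow>
      (\<forall>r. of_rat r < a \<longrightarrow> op (?u r) y = 0) \<and> (\<forall>r. a \<le> of_rat r \<longrightarrow> op (?u r) y = y)" for y
    unfolding Eq_def op_eqv[OF domr dom] at_rat_real_name[OF \<rho>]
    by (auto simp: not_le split: if_splits)
  have Eq_le: "Eq \<le> ?U a"
    unfolding le_proj_iff Eq upper_proj_def op_INF by auto
  have "op (lt_val (real_name \<rho> a) u) x = x \<longleftrightarrow>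
      (\<forall>r. of_rat r < a \<longrightarrow> op (?u r) x = 0) \<and> op Eq x = 0" (is "_ \<longleftrightarrow> ?L")
    unfolding lt_val_def op_inf op_le_val[OF domr dom] at_rat_real_name[OF \<rho>] op_uminus_fixed Eq_def
    by (auto simp: not_le)
  also have "\<dots> \<longleftrightarrow> op (?U a) x = 0"
  proof
    assume *: "op (?U a) x = 0"
    have "op (?u r) x = 0" if "of_rat r < a" for r
      using op_absorb(2)[OF le_U[OF that], of x] * by simp
    moreover have "op Eq x = 0" using op_absorb(2)[OF Eq_le, of x] * by simp
    ultimately show ?L by blast
  next
    assume L: ?L
    have "op (?u r) (op (?U a) x) = 0" if "of_rat r < a" for r
      using op_absorb(2)[OF le_U[OF that], of x] L that by simp
    moreover have "op (?u r) (op (?U a) x) = op (?U a) x" if "a \<le> of_rat r" for r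
      by (rule op_absorb(1)[OF U_le[OF that]])
    ultimately have "op Eq (op (?U a) x) = op (?U a) x" unfolding Eq by blast
    \<comment> \<open>As \<open>Eq \<le> U a\<close>, this vector is also \<open>Eq x\<close>, which
      vanishes.\<close>
    then show "op (?U a) x = 0" using op_absorb(2)[OF Eq_le, of x] L by simp
  qed
  finally have 1: "op (lt_val (real_name \<rho> a) u) x = x \<longleftrightarrow> op (?U a) x = 0" .
  have "op (le_val u (real_name \<rho> b)) x = x \<longleftrightarrow> (\<forall>r. b \<le> of_rat r \<longrightarrow> op (?u r) x = x)"
    unfolding op_le_val[OF dom domr] at_rat_real_name[OF \<rho>] by auto
  also have "\<dots> \<longleftrightarrow> op (?U b) x = x"
  proof
    assume "op (?U b) x = x"
    then show "\<forall>r. b \<le> of_rat r \<longrightarrow> op (?u r) x = x" using U_le unfolding le_proj_iff by blast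
  qed (auto simp: upper_proj_def op_INF)
  finally show ?thesis unfolding op_inf 1 by blast
qed

section \<open>Operators reduced by their spectral projections\<close>

text \<open>Cauchy-Schwarz for the real part, read off from the triangle inequality for
  \<open>x + y\<close>.\<close>

lemma Re_cinner_le_norm: "Re (cinner x y) \<le> norm x * norm (y :: 'a::complex_hilbert)"
proof -
  have "Re (cinner y x) = Re (cinner x y)" by (metis cinner_commute complex_cnj(1) complex.sel(1) cnj.sel(1))
  then have "(norm (x + y))\<^sup>2 = (norm x)\<^sup>2 + (norm y)\<^sup>2 + 2 * Re (cinner x y)"
    unfolding norm_sq by (simp add: cinner_add_left cinner_add_right)
  moreover have "(norm (x + y))\<^sup>2 \<le> (norm x + norm y)\<^sup>2"
    by (simp add: norm_triangle_ineq power_mono)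
  ultimately show ?thesis by (simp add: power2_sum)
qed

lemma cinner_scaleR_right: "cinner x (r *\<^sub>R y) = of_real r * cinner x (y :: 'a::complex_hilbert)"
  by (metis cinner_scaleC_right scaleC_of_real)

lemma cinner_scaleR_left: "cinner (r *\<^sub>R x) y = of_real r * cinner x (y :: 'a::complex_hilbert)"
  by (metis cinner_scaleC_left scaleC_of_real complex_cnj_complex_of_real)

lemma op_scaleR: "op P (r *\<^sub>R x) = r *\<^sub>R op P x"
  by (metis op_scaleC scaleC_of_real)

lemma scaleC_zero: "c *\<^sub>C (0 :: 'a::complex_hilbert) = 0"
  using scaleC_add_right[of c "0 :: 'a" 0] by simp

lemma scaleC_diff_right: "c *\<^sub>C (x - y) = c *\<^sub>C x - c *\<^sub>C (y :: 'a::complex_hilbert)"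
  using scaleC_add_right[of c "x - y" y] by (simp add: algebra_simps)

lemma scaleC_scaleR: "c *\<^sub>C (r *\<^sub>R x) = r *\<^sub>R (c *\<^sub>C (x :: 'a::complex_hilbert))"
  by (simp add: scaleC_scaleC mult.commute flip: scaleC_of_real)

lemma
  fixes f :: "'a \<Rightarrow> real"
  assumes "B \<in> sets M" "f \<in> borel_measurable M"
  shows integrable_density_indicator:
      "integrable (density M (indicator B)) f \<longleftrightarrow> integrable M (\<lambda>x. indicator B x *\<^sub>R f x)"
    and integral_density_indicator:
      "integral\<^sup>L (density M (indicator B)) f = (\<integral>x. indicator B x *\<^sub>R f x \<partial>M)"
proof -
  have 1: "(\<lambda>x. ennreal (indicator B x)) = indicator B" by (rule ext) (rule ennreal_indicator)
  show "integrable (density M (indicator B)) f \<longleftrightarrow> integrable M (\<lambda>x. indicator B x *\<^sub>R f x)"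
    by (rule integrable_density[where g = "indicator B", unfolded 1]) (use assms in auto)
  show "integral\<^sup>L (density M (indicator B)) f = (\<integral>x. indicator B x *\<^sub>R f x \<partial>M)"
    by (rule integral_density[where g = "indicator B", unfolded 1]) (use assms in auto)
qed

section \<open>Spectral measures and their restrictions\<close>

locale spectral_resolution =
  fixes A :: "'a::complex_hilbert lop" and E :: "real \<Rightarrow> 'a proj"
  assumes selfadjoint: "selfadjoint A" and resolution: "resolution_of_identity E A"
begin

lemma E_mono: "s \<le> t \<Longrightarrow> E s \<le> E t"
  using resolution by (auto simp: resolution_of_identity_def spectral_family_def mono_def)

lemma E_right: "((\<lambda>s. op (E s) x) \<longlongrightarrow> op (E r) x) (at_right r)"
  and E_bot: "((\<lambda>s. op (E s) x) \<longlongrightarrow> 0) at_bot"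
  and E_top: "((\<lambda>s. op (E s) x) \<longlongrightarrow> x) at_top"
  using resolution by (simp_all add: resolution_of_identity_def spectral_family_def)

lemma E_E: "op (E s) (op (E t) x) = op (E (min s t)) x"
  by (cases "s \<le> t") (auto simp: op_absorb E_mono min_def)

abbreviation "\<mu> \<equiv> spectral_measure E"

lemma spectral_measure_norm: "\<mu> x = interval_measure (\<lambda>s. (norm (op (E s) x))\<^sup>2)"
  by (simp add: spectral_measure_def cinner_op_self)

lemma mono_norm_E: "s \<le> t \<Longrightarrow> (norm (op (E s) x))\<^sup>2 \<le> (norm (op (E t) x))\<^sup>2"
  by (metis E_mono norm_op_le norm_ge_zero op_absorb(2) power_mono)

lemma
  shows finite_borel_spectral_measure: "finite_borel_measure (\<mu> x)"
    and emeasure_spectral_UNIV: "emeasure (\<mu> x) UNIV = ennreal ((norm x)\<^sup>2)"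
    and measure_spectral_atMost: "measure (\<mu> x) {..s} = (norm (op (E s) x))\<^sup>2"
proof -
  have 1: "continuous (at_right a) (\<lambda>s. (norm (op (E s) x))\<^sup>2)" for a
    unfolding continuous_within by (intro tendsto_intros E_right)
  have 2: "((\<lambda>s. (norm (op (E s) x))\<^sup>2) \<longlongrightarrow> 0) at_bot"
    using tendsto_power[OF tendsto_norm[OF E_bot], of x 2] by simp
  have 3: "((\<lambda>s. (norm (op (E s) x))\<^sup>2) \<longlongrightarrow> (norm x)\<^sup>2) at_top"
    by (intro tendsto_intros E_top)
  show "finite_borel_measure (\<mu> x)" "emeasure (\<mu> x) UNIV = ennreal ((norm x)\<^sup>2)"
    "measure (\<mu> x) {..s} = (norm (op (E s) x))\<^sup>2"
    unfolding spectral_measure_norm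
    using finite_borel_measure_interval_measure[OF mono_norm_E 1 2 3]
      interval_measure_UNIV[OF mono_norm_E 1 2 3]
      measure_interval_measure_Iic[OF mono_norm_E 1 2, of s] by simp_all
qed

lemma finite_spectral_measure: "finite_measure (\<mu> x)"
  using finite_borel_spectral_measure by (simp add: finite_borel_measure_def)

lemma sets_spectral_measure [simp, measurable_cong]: "sets (\<mu> x) = sets borel"
  by (simp add: spectral_measure_norm)

lemma space_spectral_measure [simp]: "space (\<mu> x) = UNIV"
  by (simp add: spectral_measure_norm)

lemma measure_spectral_UNIV: "measure (\<mu> x) UNIV = (norm x)\<^sup>2"
  by (simp add: measure_def emeasure_spectral_UNIV)

text \<open>A finite Borel measure on the line is determined by its distribution function, which for
  \<open>\<mu> y\<close> is the squared norm of \<open>E s y\<close>.\<close>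

lemma spectral_measure_restrict:
  assumes "B \<in> sets borel" "\<And>s. measure (\<mu> x) (B \<inter> {..s}) = (norm (op (E s) y))\<^sup>2"
  shows "\<mu> y = density (\<mu> x) (indicator B)"
proof (rule cdf_unique')
  interpret finite_measure "\<mu> x" by (rule finite_spectral_measure)
  show "finite_borel_measure (density (\<mu> x) (indicator B))"
    unfolding finite_borel_measure_def finite_borel_measure_axioms_def
    using assms(1) by (simp add: finite_measure_restricted)
  show "cdf (\<mu> y) = cdf (density (\<mu> x) (indicator B))"
    using assms by (simp add: cdf_def fun_eq_iff measure_spectral_atMost measure_restricted)
qed (rule finite_borel_spectral_measure)

lemma spectral_measure_E: "\<mu> (op (E l) x) = density (\<mu> x) (indicator {..l})"
  by (rule spectral_measure_restrict) (auto simp: E_E measure_spectral_atMost Int_atMost min.commute)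

lemma spectral_measure_compl: "\<mu> (x - op (E l) x) = density (\<mu> x) (indicator {l<..})"
proof (rule spectral_measure_restrict)
  fix s
  show "measure (\<mu> x) ({l<..} \<inter> {..s}) = (norm (op (E s) (x - op (E l) x)))\<^sup>2"
  proof (cases "s \<le> l")
    case True
    then have "{l<..} \<inter> {..s} = {}" by auto
    with True show ?thesis by (simp add: op_diff E_E min_absorb1)
  next
    case False
    interpret finite_borel_measure "\<mu> x" by (rule finite_borel_spectral_measure)
    have "{l<..} \<inter> {..s} = {l<..s}" by auto
    \<comment> \<open>By Pythagoras the squared norm of \<open>E s x - E l x\<close> is the
      increment of the distribution function over \<open>(l, s]\<close>.\<close>
    then show ?thesis
      using cdf_diff_eq[of l s] norm_op_Pythagoras[of "op (E s) x" "E l"] False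
      by (simp add: cdf_def measure_spectral_atMost op_diff E_E min_absorb1 min_absorb2)
  qed
qed simp

section \<open>Reduction of the operator by its spectral projections\<close>

definition T :: "'a \<Rightarrow> 'a" where "T x = the (A x)"

lemma dom_iff: "x \<in> dom A \<longleftrightarrow> integrable (\<mu> x) (\<lambda>s. s\<^sup>2)"
  using resolution by (auto simp: resolution_of_identity_def)

lemma form: "x \<in> dom A \<Longrightarrow> cinner x (T x) = complex_of_real (\<integral>s. s \<partial>\<mu> x)"
  using resolution by (auto simp: resolution_of_identity_def T_def)

lemma csubspace_dom: "csubspace (dom A)"
  using selfadjoint by (simp add: selfadjoint_def)

lemma dom_add: "x \<in> dom A \<Longrightarrow> y \<in> dom A \<Longrightarrow> x + y \<in> dom A"
  and dom_scaleC: "x \<in> dom A \<Longrightarrow> c *\<^sub>C x \<in> dom A"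
  using csubspace_dom unfolding csubspace_def by simp_all

lemmas dom_diff = csubspace_diff[OF csubspace_dom]
  and dom_scaleR = csubspace_scaleR[OF csubspace_dom]

lemma T_add: "x \<in> dom A \<Longrightarrow> y \<in> dom A \<Longrightarrow> T (x + y) = T x + T y"
  and T_scaleC: "x \<in> dom A \<Longrightarrow> T (c *\<^sub>C x) = c *\<^sub>C T x"
proof -
  have "\<forall>x\<in>dom A. \<forall>y\<in>dom A. the (A (x + y)) = the (A x) + the (A y)"
    "\<forall>c. \<forall>x\<in>dom A. the (A (c *\<^sub>C x)) = c *\<^sub>C the (A x)"
    using selfadjoint unfolding selfadjoint_def by simp_all
  then show "x \<in> dom A \<Longrightarrow> y \<in> dom A \<Longrightarrow> T (x + y) = T x + T y"
    "x \<in> dom A \<Longrightarrow> T (c *\<^sub>C x) = c *\<^sub>C T x"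
    unfolding T_def by blast+
qed

lemma T_scaleR: "x \<in> dom A \<Longrightarrow> T (r *\<^sub>R x) = r *\<^sub>R T x"
  using T_scaleC[of x "complex_of_real r"] by (simp add: scaleC_of_real)

lemma T_diff: "x \<in> dom A \<Longrightarrow> y \<in> dom A \<Longrightarrow> T (x - y) = T x - T y"
  using T_add[of "x - y" y] dom_diff by (simp add: algebra_simps)

text \<open>The test by which values are computed: a candidate \<open>z\<close> that passes it is
  the value at \<open>y\<close>, and \<open>y\<close> then belongs to the domain.\<close>

lemma T_adjoint: "A y = Some z \<longleftrightarrow> (\<forall>x\<in>dom A. cinner y (T x) = cinner z x)"
  using selfadjoint unfolding selfadjoint_def T_def by blast

lemma T_symmetric:
  assumes "x \<in> dom A" "y \<in> dom A" shows "cinner (T y) x = cinner y (T x)"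
proof -
  have "A y = Some (T y)" using assms(2) by (auto simp: T_def)
  then show ?thesis unfolding T_adjoint using assms(1) by simp
qed

lemma dom_E: "x \<in> dom A \<Longrightarrow> op (E l) x \<in> dom A"
  unfolding dom_iff spectral_measure_E
  by (subst integrable_density_indicator) (auto intro: integrable_mult_indicator simp del: real_scaleR_def)

lemma integrable_spectral_id:
  assumes "x \<in> dom A" shows "integrable (\<mu> x) (\<lambda>s. s)"
proof -
  interpret finite_measure "\<mu> x" by (rule finite_spectral_measure)
  have "integrable (\<mu> x) (\<lambda>s. 1 + s\<^sup>2)" using assms by (simp add: dom_iff)
  then show ?thesis
  proof (rule Bochner_Integration.integrable_bound)
    have "\<bar>s\<bar> \<le> 1 + s\<^sup>2" for s :: real
      using zero_le_power2[of "\<bar>s\<bar> - 1"] by (simp add: power2_diff)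
    then show "AE s in \<mu> x. norm s \<le> norm (1 + s\<^sup>2)" by simp
  qed simp
qed

text \<open>Cutting the integral for \<open>p + q\<close> at \<open>l\<close> shows that the
  quadratic form is additive on \<open>p\<close> and \<open>q\<close>, so the real part of the cross
  term vanishes. Replacing \<open>q\<close> by \<open>\<i> *\<^sub>C q\<close> disposes of the
  imaginary part.\<close>

lemma T_E_orthogonal:
  assumes "p \<in> dom A" "q \<in> dom A" "op (E l) p = p" "op (E l) q = 0"
  shows "cinner p (T q) = 0"
proof -
  have Re: "Re (cinner p (T q)) = 0" if q: "q \<in> dom A" "op (E l) q = 0" for q
  proof -
    let ?M = "\<mu> (p + q)"
    have pq: "p + q \<in> dom A" using assms q by (simp add: dom_add)
    then have int: "integrable ?M (\<lambda>s. s)" by (rule integrable_spectral_id)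
    have p: "op (E l) (p + q) = p" using assms q by (simp add: op_add)
    have "\<mu> p = density ?M (indicator {..l})" "\<mu> q = density ?M (indicator {l<..})"
      using spectral_measure_E[of l "p + q"] spectral_measure_compl[of "p + q" l] p by simp_all
    then have "(\<integral>s. s \<partial>\<mu> p) = (\<integral>s. indicator {..l} s *\<^sub>R s \<partial>?M)"
      "(\<integral>s. s \<partial>\<mu> q) = (\<integral>s. indicator {l<..} s *\<^sub>R s \<partial>?M)"
      by (simp_all add: integral_density_indicator)
    moreover have "(\<integral>s. s \<partial>?M) = (\<integral>s. indicator {..l} s *\<^sub>R s + indicator {l<..} s *\<^sub>R s \<partial>?M)"
      by (intro Bochner_Integration.integral_cong) (auto split: split_indicator)
    moreover have "\<dots> = (\<integral>s. indicator {..l} s *\<^sub>R s \<partial>?M) + (\<integral>s. indicator {l<..} s *\<^sub>R s \<partial>?M)"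
      by (intro Bochner_Integration.integral_add integrable_mult_indicator int) auto
    ultimately have "cinner (p + q) (T (p + q)) = cinner p (T p) + cinner q (T q)"
      using assms q pq by (simp add: form)
    then have "cinner p (T q) + cinner q (T p) = 0"
      using assms q by (simp add: T_add cinner_add_left cinner_add_right add.commute)
    moreover have "cinner q (T p) = cnj (cinner p (T q))"
      using T_symmetric[of p q] cinner_commute[of "T q" p] assms q by simp
    ultimately show ?thesis by (simp add: complex_eq_iff)
  qed
  have "Re (cinner p (T (\<i> *\<^sub>C q))) = 0"
    using assms by (intro Re) (auto simp: dom_scaleC op_scaleC scaleC_zero)
  then have "Im (cinner p (T q)) = 0" using assms by (simp add: T_scaleC cinner_scaleC_right)
  with Re[OF assms(2,4)] show ?thesis by (simp add: complex_eq_iff)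
qed

text \<open>Since the cross terms vanish by \<open>T_E_orthogonal\<close>, the vector
  \<open>E l (T y)\<close> passes the adjoint test at \<open>E l y\<close>.\<close>

lemma T_E: assumes "y \<in> dom A" shows "T (op (E l) y) = op (E l) (T y)"
proof -
  have "\<forall>x\<in>dom A. cinner (op (E l) y) (T x) = cinner (op (E l) (T y)) x"
  proof
    fix x assume x: "x \<in> dom A"
    note D = x assms dom_E[OF x, of l] dom_E[OF assms, of l]
    have 1: "cinner (op (E l) y') (T (x' - op (E l) x')) = 0" if "x' \<in> dom A" "y' \<in> dom A" for x' y'
      using that by (intro T_E_orthogonal[where l = l]) (auto simp: dom_diff dom_E op_diff)
    have "cinner (op (E l) y) (T x) = cinner (op (E l) y) (T (op (E l) x))"
      using 1[OF x assms] D by (simp add: T_diff cinner_diff_right)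
    also have "\<dots> = cinner (T (op (E l) y)) (op (E l) x)" using D by (simp add: T_symmetric)
    also have "\<dots> = cinner (T y) (op (E l) x)"
    proof -
      have "cinner (T (y - op (E l) y)) (op (E l) x) = 0"
        using 1[OF assms x] by (metis cinner_commute complex_cnj_zero)
      then show ?thesis using D by (simp add: T_diff cinner_diff_left)
    qed
    finally show "cinner (op (E l) y) (T x) = cinner (op (E l) (T y)) x" by (simp add: cinner_op)
  qed
  then show ?thesis unfolding T_adjoint[symmetric] by (simp add: T_def)
qed

section \<open>Bounds on spectral subspaces\<close>

lemma AE_spectral_le:
  assumes "op (E l) x = x" shows "AE s in \<mu> x. s \<le> l"
proof -
  have "\<mu> x = density (\<mu> x) (indicator {..l})" using spectral_measure_E[of l x] assms by simp
  moreover have "AE s in density (\<mu> x) (indicator {..l}). s \<le> l"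
    by (subst AE_density) (auto split: split_indicator)
  ultimately show ?thesis by (rule ssubst)
qed

lemma AE_spectral_gt:
  assumes "op (E l) x = 0" shows "AE s in \<mu> x. l < s"
proof -
  have "\<mu> x = density (\<mu> x) (indicator {l<..})" using spectral_measure_compl[of x l] assms by simp
  moreover have "AE s in density (\<mu> x) (indicator {l<..}). l < s"
    by (subst AE_density) (auto split: split_indicator)
  ultimately show ?thesis by (rule ssubst)
qed

lemma form_upper:
  assumes "x \<in> dom A" "op (E l) x = x" shows "Re (cinner x (T x)) \<le> l * (norm x)\<^sup>2"
proof -
  interpret finite_measure "\<mu> x" by (rule finite_spectral_measure)
  have "(\<integral>s. s \<partial>\<mu> x) \<le> (\<integral>s. l \<partial>\<mu> x)"
    by (intro integral_mono_AE integrable_spectral_id assms AE_spectral_le) auto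
  then show ?thesis using assms by (simp add: form measure_spectral_UNIV mult.commute)
qed

lemma form_lower:
  assumes "x \<in> dom A" "op (E l) x = 0" shows "l * (norm x)\<^sup>2 \<le> Re (cinner x (T x))"
proof -
  interpret finite_measure "\<mu> x" by (rule finite_spectral_measure)
  have "(\<integral>s. l \<partial>\<mu> x) \<le> (\<integral>s. s \<partial>\<mu> x)"
    by (intro integral_mono_AE integrable_spectral_id assms)
      (use AE_spectral_gt[OF assms(2)] in auto)
  then show ?thesis using assms by (simp add: form measure_spectral_UNIV mult.commute)
qed

text \<open>The finite measure of \<open>x\<close> lives between \<open>k\<close> and
  \<open>l\<close>, where \<open>s\<^sup>2\<close> is bounded.\<close>

lemma bounded_part_in_dom:
  assumes "op (E l) x = x" "op (E k) x = 0" shows "x \<in> dom A"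
proof -
  interpret finite_measure "\<mu> x" by (rule finite_spectral_measure)
  have "AE s in \<mu> x. norm (s\<^sup>2) \<le> (max \<bar>k\<bar> \<bar>l\<bar>)\<^sup>2"
    using AE_spectral_le[OF assms(1)] AE_spectral_gt[OF assms(2)]
    by eventually_elim (auto simp: simp flip: abs_le_square_iff)
  then show ?thesis unfolding dom_iff by (rule integrable_const_bound) simp
qed

text \<open>With \<open>B = T - k\<close> and \<open>c = l - k\<close>, the bound follows from \<open>0 \<le> B \<le> c\<close> by the identity
  \<open>c (c B - B\<^sup>2) = B (c - B) B + (c - B) B (c - B)\<close>.\<close>

lemma norm_bounded_part:
  assumes "k < l" "op (E l) x = x" "op (E k) x = 0"
  shows "norm (T x - k *\<^sub>R x) \<le> (l - k) * norm x"
proof -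
  \<comment> \<open>\<open>S\<close> is the range of \<open>E l - E k\<close> for
    \<open>k < l\<close>; \<open>B\<close> maps it to itself and is symmetric there, with form
    between 0 and \<open>c\<close>.\<close>
  define S where "S = {x. op (E l) x = x \<and> op (E k) x = 0}"
  define B where "B x = T x - k *\<^sub>R x" for x
  define c where "c = l - k"
  have c: "c > 0" using assms(1) by (simp add: c_def)
  have dom: "x \<in> dom A" if "x \<in> S" for x
    using that bounded_part_in_dom by (auto simp: S_def)
  \<comment> \<open>\<open>T_scaleR\<close> with factor 0 supplies \<open>T 0 = 0\<close>, hence
    \<open>E k (T x) = 0\<close>.\<close>
  have B_S: "B x \<in> S" if "x \<in> S" for x
    using that T_E[OF dom[OF that], of l] T_E[OF dom[OF that], of k] T_scaleR[OF dom[OF that], of 0]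
    by (auto simp: S_def B_def op_diff op_scaleR)
  have lower: "0 \<le> Re (cinner x (B x))" if "x \<in> S" for x
    using form_lower[OF dom[OF that], of k] that
    by (simp add: S_def B_def cinner_diff_right cinner_scaleR_right cinner_self)
  have upper: "Re (cinner x (B x)) \<le> c * (norm x)\<^sup>2" if "x \<in> S" for x
    using form_upper[OF dom[OF that], of l] that
    by (simp add: S_def B_def c_def cinner_diff_right cinner_scaleR_right cinner_self algebra_simps)
  have sym: "cinner (B x) y = cinner x (B y)" if "x \<in> S" "y \<in> S" for x y
    using T_symmetric[OF dom dom, OF that(2,1)]
    by (simp add: B_def cinner_diff_left cinner_diff_right cinner_scaleR_left cinner_scaleR_right)
  have x: "x \<in> S" using assms by (simp add: S_def)
  define u where "u = B x"
  define v where "v = B u"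
  have u: "u \<in> S" using B_S x by (simp add: u_def)
  have w: "c *\<^sub>R x - u \<in> S" using x u by (simp add: S_def op_diff op_scaleR)
  have "T (c *\<^sub>R x - u) = c *\<^sub>R T x - T u"
    using dom[OF x] dom[OF u] by (simp add: T_diff T_scaleR dom_scaleR)
  then have Bw: "B (c *\<^sub>R x - u) = c *\<^sub>R u - v"
    by (simp add: B_def v_def u_def[unfolded B_def] algebra_simps)
  have xu: "cinner u x = cinner x u" using sym[OF x x] by (simp add: u_def)
  have xv: "cinner x v = cinner u u" using sym[OF x u] by (simp add: u_def v_def)
  \<comment> \<open>Positivity of \<open>B\<close> at the vector \<open>(c - B) x\<close>: this is
    the summand \<open>(c - B) B (c - B)\<close>.\<close>
  have "0 \<le> Re (cinner (c *\<^sub>R x - u) (c *\<^sub>R u - v))"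
    using lower[OF w] by (simp add: Bw)
  also have "\<dots> = c\<^sup>2 * Re (cinner x u) - 2 * c * (norm u)\<^sup>2 + Re (cinner u v)"
    by (simp add: cinner_diff_left cinner_diff_right cinner_scaleR_left cinner_scaleR_right xv
        cinner_self power2_eq_square algebra_simps)
  \<comment> \<open>Adds the summand \<open>B (c - B) B\<close>, which is nonnegative by the upper
    bound at \<open>u = B x\<close>.\<close>
  also have "\<dots> \<le> c\<^sup>2 * Re (cinner x u) - c * (norm u)\<^sup>2"
    using upper[OF u] by (simp add: v_def)
  also have "\<dots> \<le> c\<^sup>2 * (c * (norm x)\<^sup>2) - c * (norm u)\<^sup>2"
    using upper[OF x] by (simp add: u_def mult_left_mono)
  also have "\<dots> = c * ((c * norm x)\<^sup>2 - (norm u)\<^sup>2)"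
    by (simp add: power2_eq_square algebra_simps)
  finally have "0 \<le> (c * norm x)\<^sup>2 - (norm u)\<^sup>2"
    using c by (metis mult_le_cancel_left_pos mult_zero_right)
  then have "norm u \<le> c * norm x"
    using c by - (rule power2_le_imp_le, simp_all)
  then show ?thesis unfolding u_def B_def c_def .
qed

text \<open>For \<open>k < l < m\<close> the operator \<open>Z = (1 - E m) U (E l - E k)\<close> intertwines the parts of \<open>T - k\<close> on the
  two ranges, where it is bounded above by \<open>l - k\<close> and below by \<open>m - k\<close>; iterating, \<open>Z = 0\<close>.\<close>

lemma intertwiner_zero:
  assumes "k < l" "l < m" and "op (E l) x = x" "op (E k) x = 0"
    and lin: "bounded_linear U" and le: "\<And>x. norm (U x) \<le> norm x"
    and comm: "\<And>x. x \<in> dom A \<Longrightarrow> U x \<in> dom A \<and> T (U x) = U (T x)"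
  shows "op (E m) (U x) = U x"
proof -
  interpret U: bounded_linear U by (rule lin)
  define Z where "Z x = U x - op (E m) (U x)" for x
  \<comment> \<open>The ratio of the upper bound on the source side to the lower bound on the target
    side; it is below 1 because \<open>l < m\<close>.\<close>
  define q where "q = (l - k) / (m - k)"
  have q: "0 < q" "q < 1" "(m - k) * q = l - k" using assms(1,2) by (auto simp: q_def)
  \<comment> \<open>Stated for all vectors of the spectral subspace, as the induction step applies
    it to \<open>T x - k *\<^sub>R x\<close> in place of \<open>x\<close>.\<close>
  have "\<forall>x. op (E l) x = x \<and> op (E k) x = 0 \<longrightarrow> norm (Z x) \<le> q ^ j * norm x" for j
  proof (induction j)
    case 0
    have "norm (Z x) \<le> norm (U x)" for x
      using norm_op_le[of "- E m" "U x"] by (simp add: Z_def op_uminus)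
    then show ?case using order_trans[OF _ le] by simp
  next
    case (Suc j)
    show ?case
    proof (intro allI impI, elim conjE)
      fix x assume x: "op (E l) x = x" "op (E k) x = 0"
      define Bx where "Bx = T x - k *\<^sub>R x"
      have D: "x \<in> dom A" using bounded_part_in_dom x by blast
      have UD: "U x \<in> dom A" "T (U x) = U (T x)" using comm[OF D] by auto
      have ZD: "Z x \<in> dom A" unfolding Z_def using UD dom_E dom_diff by blast
      \<comment> \<open>Both \<open>U\<close> and \<open>E m\<close> commute with \<open>T\<close>
        on the domain, so \<open>Z\<close> passes through \<open>T - k\<close>.\<close>
      have "T (Z x) - k *\<^sub>R Z x = Z Bx"
        unfolding Z_def Bx_def using UD
        by (simp add: T_diff dom_E T_E U.diff U.scaleR op_diff op_scaleR algebra_simps)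
      moreover have "m * (norm (Z x))\<^sup>2 \<le> Re (cinner (Z x) (T (Z x)))"
        by (rule form_lower[OF ZD]) (simp add: Z_def op_diff)
      ultimately have "(m - k) * (norm (Z x))\<^sup>2 \<le> Re (cinner (Z x) (Z Bx))"
        by (simp add: cinner_diff_right cinner_scaleR_right cinner_self algebra_simps
            flip: \<open>T (Z x) - k *\<^sub>R Z x = Z Bx\<close>)
      also have "\<dots> \<le> norm (Z x) * norm (Z Bx)" by (rule Re_cinner_le_norm)
      also have "\<dots> \<le> norm (Z x) * (q ^ j * norm Bx)"
      proof (intro mult_left_mono)
        have "op (E l) Bx = Bx" "op (E k) Bx = 0"
          using x T_E[OF D, of l] T_E[OF D, of k] T_scaleR[OF D, of 0]
          by (simp_all add: Bx_def op_diff op_scaleR)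
        then show "norm (Z Bx) \<le> q ^ j * norm Bx" using Suc by blast
      qed simp
      also have "\<dots> \<le> norm (Z x) * (q ^ j * ((l - k) * norm x))"
        using norm_bounded_part[OF assms(1) x] q by (intro mult_left_mono) (auto simp: Bx_def)
      also have "\<dots> = (m - k) * norm (Z x) * (q ^ Suc j * norm x)"
        by (simp flip: q(3))
      finally have "(m - k) * norm (Z x) * norm (Z x) \<le> (m - k) * norm (Z x) * (q ^ Suc j * norm x)"
        by (simp add: power2_eq_square mult.assoc)
      then show "norm (Z x) \<le> q ^ Suc j * norm x"
        using assms(1,2) q by (cases "Z x = 0") (auto simp: mult_le_cancel_left)
    qed
  qed
  then have "norm (Z x) \<le> q ^ j * norm x" for j using assms by blast
  moreover have "(\<lambda>j. q ^ j * norm x) \<longlonglongrightarrow> 0 * norm x"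
    using q by (intro tendsto_intros) auto
  ultimately have "norm (Z x) \<le> 0" by (intro LIMSEQ_le_const) auto
  then show ?thesis by (simp add: Z_def)
qed

text \<open>\<open>intertwiner_zero\<close> applies to the truncation \<open>x - E k x\<close>. As
  \<open>k\<close> tends to minus infinity, it puts \<open>U x\<close> into the range of every
  \<open>E m\<close> with \<open>m > l\<close>; right continuity then lets \<open>m\<close> decrease
  to \<open>l\<close>.\<close>

lemma E_invariant:
  assumes x: "op (E l) x = x"
    and lin: "bounded_linear U" and le: "\<And>x. norm (U x) \<le> norm x"
    and comm: "\<And>x. x \<in> dom A \<Longrightarrow> U x \<in> dom A \<and> T (U x) = U (T x)"
  shows "op (E l) (U x) = U x"
proof -
  interpret U: bounded_linear U by (rule lin)
  have fix_m: "op (E m) (U x) = U x" if m: "l < m" for m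
  proof -
    have ev: "\<forall>\<^sub>F k in at_bot. op (E m) (U (x - op (E k) x)) = U (x - op (E k) x)"
      using eventually_gt_at_bot[of l]
    proof eventually_elim
      case (elim k)
      then show ?case
        by (intro intertwiner_zero[OF _ m _ _ lin le comm])
          (auto simp: op_diff E_E min_def x)
    qed
    have 1: "((\<lambda>k. x - op (E k) x) \<longlongrightarrow> x - 0) at_bot"
      by (intro tendsto_intros E_bot)
    have 2: "((\<lambda>k. op (E m) (U (x - op (E k) x))) \<longlongrightarrow> op (E m) (U (x - 0))) at_bot"
      by (intro bounded_linear.tendsto[OF bounded_linear_op] U.tendsto 1)
    have 3: "((\<lambda>k. op (E m) (U (x - op (E k) x))) \<longlongrightarrow> U (x - 0)) at_bot"
      by (rule Lim_transform_eventually[OF U.tendsto[OF 1]]) (use ev in eventually_elim, simp)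
    from tendsto_unique[OF _ 2 3] show ?thesis by simp
  qed
  have "((\<lambda>m. op (E m) (U x)) \<longlongrightarrow> U x) (at_right l)"
    by (rule tendsto_eventually) (use fix_m in \<open>auto simp: eventually_at_filter\<close>)
  from tendsto_unique[OF _ E_right this] show ?thesis by simp
qed

text \<open>The reflection \<open>1 - 2 P\<close> is isometric and commutes with the operator, so it
  leaves the range of \<open>E l\<close> invariant, and hence so does \<open>P\<close>. Taking
  adjoints in \<open>E P E = P E\<close> gives \<open>E P E = E P\<close>.\<close>

lemma E_commutes:
  assumes comm: "\<And>x. x \<in> dom A \<Longrightarrow>
    x - 2 *\<^sub>R op P x \<in> dom A \<and> T (x - 2 *\<^sub>R op P x) = T x - 2 *\<^sub>R op P (T x)"
  shows "op (E l) \<circ> op P = op P \<circ> op (E l)"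
proof -
  let ?U = "\<lambda>x. x - 2 *\<^sub>R op P x"
  have lin: "bounded_linear ?U"
    by (intro bounded_linear_sub bounded_linear_ident bounded_linear_const_scaleR bounded_linear_op)
  have U: "norm (?U x) = norm x" for x
  proof -
    have "(norm (?U x))\<^sup>2 = (norm x)\<^sup>2"
      unfolding norm_sq
      by (simp add: cinner_diff_left cinner_diff_right cinner_scaleR_left cinner_scaleR_right cinner_op)
    then show ?thesis by simp
  qed
  have 1: "op (E l) (op P (op (E l) y)) = op P (op (E l) y)" for y
  proof -
    have "op (E l) (?U (op (E l) y)) = ?U (op (E l) y)"
      by (rule E_invariant[OF _ lin]) (auto simp: U comm)
    then show ?thesis by (simp add: op_diff op_scaleR)
  qed
  have "cinner (op (E l) (op P x) - op P (op (E l) x)) y = 0" for x y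
  proof -
    have "cinner (op (E l) (op P x)) y = cinner x (op P (op (E l) y))" by (simp add: cinner_op)
    also have "\<dots> = cinner x (op (E l) (op P (op (E l) y)))" by (simp add: 1)
    also have "\<dots> = cinner (op (E l) (op P (op (E l) x))) y" by (simp add: cinner_op)
    finally show ?thesis by (simp add: 1 cinner_diff_left)
  qed
  then have "op (E l) (op P x) = op P (op (E l) x)" for x by (metis cinner_eq_zero eq_iff_diff_eq_0)
  then show ?thesis by auto
qed

end

section \<open>Affiliation and the interval\<close>

text \<open>Affiliation is tested on unitaries, and \<open>1 - 2 P\<close> is a unitary that
  commutes with whatever \<open>P\<close> commutes with.\<close>

lemma reflection_in_commutant:
  assumes "P \<in> proj_commutant Q"
  defines "U \<equiv> \<lambda>x. x - 2 *\<^sub>R op P x"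
  shows "U \<in> commutant (commutant (commutant (op ` Q)))" "unitary U" "U \<circ> U = id"
proof -
  have UU: "U (U x) = x" for x by (simp add: U_def op_diff op_scaleR algebra_simps flip: scaleR_add_left)
  then show "U \<circ> U = id" by auto
  have lin: "clinear U"
    by (simp add: clinear_def U_def op_add op_scaleC scaleC_scaleR scaleC_diff_right algebra_simps)
  have "cinner (U x) (U y) = cinner x y" for x y
    by (simp add: U_def cinner_diff_left cinner_diff_right cinner_scaleR_left cinner_scaleR_right cinner_op)
  then show "unitary U" using lin UU unfolding unitary_def surj_def by metis
  have bdd: "bounded_op U"
    unfolding bounded_op_def using lin unfolding U_def
    by (intro conjI bounded_linear_sub bounded_linear_ident bounded_linear_const_scaleR bounded_linear_op)
  have "U \<in> commutant (op ` Q)"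
    using assms(1) bdd
    by (auto simp: commutant_def proj_commutant_def U_def fun_eq_iff op_diff op_scaleR)
  \<comment> \<open>Every commutant lies in its own bicommutant.\<close>
  with bdd show "U \<in> commutant (commutant (commutant (op ` Q)))"
    unfolding commutant_def by (simp; metis)
qed

text \<open>As \<open>Q\<close> is its own double commutant among projections, it is enough that
  \<open>E l\<close> commutes with each \<open>P\<close> in \<open>proj_commutant Q\<close>;
  \<open>E_commutes\<close> reduces this to the reflection of \<open>P\<close>.\<close>

lemma (in spectral_resolution) affiliated_E:
  assumes "is_logic Q" "affiliated A (commutant (commutant (op ` Q)))"
  shows "E l \<in> Q"
proof -
  have "op (E l) \<circ> op P = op P \<circ> op (E l)" if P: "P \<in> proj_commutant Q" for P
  proof (rule E_commutes)
    fix x assume x: "x \<in> dom A"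
    define U where "U = (\<lambda>x. x - 2 *\<^sub>R op P x)"
    note U = reflection_in_commutant[OF P, folded U_def]
    have "inv U = U" using U(3) by (intro inv_unique_comp)
    then have "map_option U (A (U x)) = A x"
      using assms(2) U(1,2) unfolding affiliated_def by (metis (no_types, lifting))
    then have "U x \<in> dom A \<and> U (T (U x)) = T x"
      using x by (auto simp: T_def)
    \<comment> \<open>\<open>U \<circ> U = id\<close> turns \<open>U A U = A\<close> into
      \<open>A U = U A\<close>.\<close>
    then have "U x \<in> dom A \<and> T (U x) = U (T x)"
      using U(3) by (metis comp_apply id_apply)
    then show "x - 2 *\<^sub>R op P x \<in> dom A \<and> T (x - 2 *\<^sub>R op P x) = T x - 2 *\<^sub>R op P (T x)"
      by (simp add: U_def)
  qed
  then have "E l \<in> proj_commutant (proj_commutant Q)" by (simp add: proj_commutant_def)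
  then show ?thesis using assms(1) by (simp add: is_logic_def)
qed

section \<open>Passage from rational to real arguments\<close>

lemma filterlim_at_right_rat_seq:
  fixes c :: real
  obtains r :: "nat \<Rightarrow> rat" where "\<And>n. c < of_rat (r n)" "filterlim (\<lambda>n. of_rat (r n)) (at_right c) sequentially"
proof -
  have "\<exists>r. c < of_rat r \<and> of_rat r < c + 1 / real (Suc n)" for n
    by (rule of_rat_dense) simp
  then obtain r where r: "\<And>n. c < of_rat (r n)" "\<And>n. of_rat (r n) < c + 1 / real (Suc n)" by metis
  have "(\<lambda>n. c + 1 / real (Suc n)) \<longlonglongrightarrow> c + 0"
    by (intro tendsto_intros LIMSEQ_Suc lim_1_over_n)
  then have upper: "(\<lambda>n. c + 1 / real (Suc n)) \<longlonglongrightarrow> c" by (simp del: of_nat_Suc)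
  have "\<forall>\<^sub>F n in sequentially. c \<le> of_rat (r n)"
    "\<forall>\<^sub>F n in sequentially. of_rat (r n) \<le> c + 1 / real (Suc n)"
    by (rule always_eventually, rule allI, rule less_imp_le, rule r)+
  from tendsto_sandwich[OF this tendsto_const upper] have "(\<lambda>n. of_rat (r n)) \<longlonglongrightarrow> c" .
  moreover have "of_rat (r n) \<in> {c<..} \<and> of_rat (r n) \<noteq> c" for n
    using r(1)[of n] by simp
  ultimately have "filterlim (\<lambda>n. of_rat (r n)) (at_right c) sequentially"
    unfolding filterlim_at by simp
  with r(1) show thesis by (rule that)
qed

context spectral_resolution
begin

text \<open>Let rationals \<open>r n\<close> tend to \<open>c\<close> from the right. Then
  \<open>u (r n) x\<close> tends to \<open>y = E c x\<close>. Every value at \<open>s > c\<close>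
  fixes \<open>y\<close>, so \<open>U y = y\<close>; and \<open>U x = U (u (r n) x)\<close> tends to
  \<open>U y\<close>.\<close>

lemma upper_proj_eq:
  fixes \<rho> :: "rat \<Rightarrow> ('a, 'k) index V"
  assumes "\<And>r. op (at_rat \<rho> u r) x = op (E (of_rat r)) x"
    and mono: "\<And>r s. r \<le> s \<Longrightarrow> at_rat \<rho> u r \<le> at_rat \<rho> u s"
  shows "op (upper_proj \<rho> u c) x = op (E c) x"
proof -
  let ?u = "at_rat \<rho> u" and ?U = "upper_proj \<rho> u c" and ?y = "op (E c) x"
  obtain r :: "nat \<Rightarrow> rat" where r: "\<And>n. c < of_rat (r n)"
    and lim: "filterlim (\<lambda>n. of_rat (r n)) (at_right c) sequentially"
    by (rule filterlim_at_right_rat_seq[of c]) blast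
  have "(\<lambda>n. op (E (of_rat (r n))) x) \<longlonglongrightarrow> ?y"
    using filterlim_compose[OF E_right lim] .
  then have u_lim: "(\<lambda>n. op (?u (r n)) x) \<longlonglongrightarrow> ?y" by (simp add: assms(1))
  have "op (?u s) ?y = ?y" if s: "c < of_rat s" for s
  proof -
    have "\<forall>\<^sub>F n in sequentially. of_rat (r n) \<in> {c<..<of_rat s}"
      using lim eventually_at_right_real[OF s] unfolding filterlim_iff by blast
    then have "\<forall>\<^sub>F n in sequentially. op (?u (r n)) x = op (?u s) (op (?u (r n)) x)"
      by eventually_elim (simp add: of_rat_less op_absorb(1)[OF mono])
    from tendsto_cong[OF this, of ?y] u_lim
    have "(\<lambda>n. op (?u s) (op (?u (r n)) x)) \<longlonglongrightarrow> ?y" by simp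
    moreover have "(\<lambda>n. op (?u s) (op (?u (r n)) x)) \<longlonglongrightarrow> op (?u s) ?y"
      by (rule bounded_linear.tendsto[OF bounded_linear_op u_lim])
    ultimately show ?thesis by (rule LIMSEQ_unique[symmetric])
  qed
  then have 1: "op ?U ?y = ?y" by (simp add: upper_proj_def op_INF)
  have "?U \<le> ?u (r n)" for n unfolding upper_proj_def by (rule INF_lower) (simp add: r)
  then have "op ?U (op (?u (r n)) x) = op ?U x" for n by (rule op_absorb(2))
  moreover have "(\<lambda>n. op ?U (op (?u (r n)) x)) \<longlonglongrightarrow> op ?U ?y"
    by (rule bounded_linear.tendsto[OF bounded_linear_op u_lim])
  ultimately have "op ?U x = op ?U ?y" by (simp add: LIMSEQ_const_iff)
  with 1 show ?thesis by simp
qed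

text \<open>The clauses of a cut come from the limits of \<open>E\<close> at plus and minus
  infinity, taken along \<open>n\<close> and \<open>- n\<close>, and from right continuity.\<close>

lemma op_name_in_reals:
  fixes \<rho> :: "rat \<Rightarrow> ('a, 'k) index V"
  assumes \<rho>: "inj \<rho>" and Q: "top \<in> Q" "\<And>l. E l \<in> Q"
  shows "op_name \<rho> E \<in> reals Q \<rho>"
proof -
  let ?A = "op_name \<rho> E"
  have dom: "ndom ?A = ndom (check (ratset \<rho>))"
    unfolding op_name_def by (rule ndom_rat_fun)
  have app: "at_rat \<rho> ?A r = E (of_rat r)" for r
    unfolding op_name_def by (rule at_rat_rat_fun[OF \<rho>])
  have "single_valued (graph ?A)"
    using \<rho> by (auto simp: op_name_def single_valued_def graph_rat_fun inj_eq[OF inj_check] inj_eq)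
  then have univ: "?A \<in> universe Q"
    by (rule universe.intros)
      (auto simp: dom ndom_check_ratset app Q check_in_universe)
  have sup: "(\<Squnion>r. E (of_rat r)) = top"
    unfolding SUP_proj_eq_top
  proof (intro allI impI)
    fix x assume *: "\<forall>r\<in>UNIV. op (E (of_rat r)) x = 0"
    have "(\<lambda>n. op (E (real n)) x) \<longlonglongrightarrow> x"
      using filterlim_compose[OF E_top filterlim_real_sequentially] .
    moreover have "op (E (real n)) x = 0" for n using *[rule_format, of "of_nat n"] by simp
    ultimately show "x = 0" by (simp add: LIMSEQ_const_iff)
  qed
  have inf: "(\<Squnion>r. - E (of_rat r)) = top"
    unfolding SUP_proj_eq_top
  proof (intro allI impI)
    fix x assume *: "\<forall>r\<in>UNIV. op (- E (of_rat r)) x = 0"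
    have "(\<lambda>n. op (E (- real n)) x) \<longlonglongrightarrow> 0"
      using filterlim_compose[OF E_bot filterlim_compose[OF filterlim_uminus_at_bot_at_top
        filterlim_real_sequentially]] .
    moreover have "op (E (- real n)) x = x" for n
      using *[rule_format, of "- of_nat n"] by (simp add: op_uminus of_rat_minus)
    ultimately show "x = 0" by (simp add: LIMSEQ_const_iff)
  qed
  have cont: "E (of_rat r) = (\<Sqinter>s\<in>{r<..}. E (of_rat s))" for r
  proof -
    have "upper_proj \<rho> ?A (of_rat r) = (\<Sqinter>s\<in>{r<..}. E (of_rat s))"
      by (simp add: upper_proj_def app of_rat_less greaterThan_def)
    \<comment> \<open>\<open>upper_proj_eq\<close> is applied to the name of the operator itself,
      whose values agree with \<open>E\<close> at every vector.\<close>
    moreover have "upper_proj \<rho> ?A (of_rat r) = E (of_rat r)"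
      by (rule proj_eqI', subst upper_proj_eq) (auto simp: app E_mono of_rat_less_eq)
    ultimately show ?thesis by simp
  qed
  have "real_val \<rho> ?A = top"
    unfolding real_val_eq_top[OF \<rho> dom] app using sup inf cont by blast
  with univ dom show ?thesis by (simp add: reals_def)
qed

lemma mem_op_name_interval:
  fixes \<rho> :: "rat \<Rightarrow> ('a, 'k) index V"
  assumes \<rho>: "inj \<rho>" and Q: "top \<in> Q" "\<And>l. E l \<in> Q"
  shows "mem (op_name \<rho> E) (interval_name Q \<rho> a b) = - E a \<sqinter> E b"
proof -
  let ?A = "op_name \<rho> E" and ?I = "interval_name Q \<rho> a b"
  let ?f = "\<lambda>u. lt_val (real_name \<rho> a) u \<sqinter> le_val u (real_name \<rho> b)"
  have dom: "ndom u = ndom (check (ratset \<rho>))" if "u \<in> reals Q \<rho>" for u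
    using that by (simp add: reals_def)
  have A: "?A \<in> reals Q \<rho>" by (rule op_name_in_reals[OF \<rho> Q])
  have app: "at_rat \<rho> ?A r = E (of_rat r)" for r
    unfolding op_name_def by (rule at_rat_rat_fun[OF \<rho>])
  have graph_I: "graph ?I = (\<lambda>u. (u, ?f u)) ` reals Q \<rho>" by (rule graph_interval_name)
  then have "single_valued (graph ?I)" by (auto simp: single_valued_def)
  from app_eq[OF this] graph_I have I: "app ?I u = ?f u" if "u \<in> reals Q \<rho>" for u
    using that by blast
  have dom_I: "ndom ?I = reals Q \<rho>" by (auto simp: ndom_def graph_I)
  have eq: "op (app ?I u \<sqinter> eqv ?A u) x = x \<longleftrightarrow>
      op (- E a \<sqinter> E b) x = x \<and> (\<forall>r. op (E (of_rat r)) x = op (at_rat \<rho> u r) x)"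
    if u: "u \<in> reals Q \<rho>" for u x
  proof -
    have "real_val \<rho> u = top" using u by (simp add: reals_def)
    then have cont: "at_rat \<rho> u r = (\<Sqinter>s\<in>{r<..}. at_rat \<rho> u s)" for r
      unfolding real_val_eq_top[OF \<rho> dom[OF u]] by blast
    have mono: "at_rat \<rho> u r \<le> at_rat \<rho> u s" if "r \<le> s" for r s
      unfolding cont[of r] cont[of s] using that by (intro INF_superset_mono) auto
    \<comment> \<open>Agreement at the rationals for this one \<open>x\<close> carries over to the
      endpoints \<open>a\<close> and \<open>b\<close>.\<close>
    have "op (upper_proj \<rho> u c) x = op (E c) x" if "\<forall>r. op (E (of_rat r)) x = op (at_rat \<rho> u r) x" for c
      using that by (intro upper_proj_eq mono) simp_all
    then show ?thesis
      unfolding I[OF u] op_inf[of "?f u"] op_interval_value[OF \<rho> u] op_eqv[OF dom[OF A] dom[OF u]] app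
      by (auto simp: op_inf op_uminus_fixed)
  qed
  have "mem ?A ?I = (\<Squnion>u\<in>reals Q \<rho>. app ?I u \<sqinter> eqv ?A u)" by (simp add: mem_def dom_I)
  also have "\<dots> = - E a \<sqinter> E b"
  proof (rule antisym)
    show "(\<Squnion>u\<in>reals Q \<rho>. app ?I u \<sqinter> eqv ?A u) \<le> - E a \<sqinter> E b"
      by (rule SUP_least) (simp add: le_proj_iff eq)
    show "- E a \<sqinter> E b \<le> (\<Squnion>u\<in>reals Q \<rho>. app ?I u \<sqinter> eqv ?A u)"
      by (rule SUP_upper2[OF A]) (simp add: le_proj_iff eq[OF A] app)
  qed
  finally show ?thesis .
qed

end

theorem theorem6p2:
  fixes Q :: "'h::complex_hilbert proj set"
    and A :: "'h lop"
    and E :: "real \<Rightarrow> 'h proj"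
    and \<rho> :: "rat \<Rightarrow> ('h, 'k) index V"
    and a b :: real
  assumes "is_logic Q"
    and "inj \<rho>"
    and "selfadjoint A"
    and "affiliated A (commutant (commutant (op ` Q)))"
    and "resolution_of_identity E A"
    and "a < b"
  shows "op (mem (op_name \<rho> E) (interval_name Q \<rho> a b)) = (\<lambda>x. op (E b) x - op (E a) x)"
proof -
  interpret spectral_resolution A E by unfold_locales (use assms in auto)
  have "top \<in> proj_commutant (proj_commutant Q)" by (auto simp: proj_commutant_def)
  then have "top \<in> Q" using assms(1) by (simp add: is_logic_def)
  then have mem: "mem (op_name \<rho> E) (interval_name Q \<rho> a b) = - E a \<sqinter> E b"
    using mem_op_name_interval assms(1,2,4) affiliated_E by blast
  have ab: "E a \<le> E b" using assms(6) by (simp add: E_mono)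
  \<comment> \<open>The meet kills the range of \<open>E a\<close> and absorbs \<open>E b\<close>,
    so it has the same value at \<open>x\<close> as at \<open>E b x - E a x\<close>; the latter
    vector is fixed because \<open>E a \<le> E b\<close>.\<close>
  have "op (- E a \<sqinter> E b) x = op (E b) x - op (E a) x" for x
  proof -
    let ?R = "- E a \<sqinter> E b"
    have "op ?R (op (- E a) x) = op ?R x" by (rule op_absorb(2)) simp
    then have Ea: "op ?R (op (E a) x) = 0" by (simp add: op_uminus op_diff)
    have "op ?R x = op ?R (op (E b) x)" by (rule op_absorb(2)[symmetric]) simp
    also have "\<dots> = op ?R (op (E b) x - op (E a) x)" by (simp add: op_diff Ea)
    also have "\<dots> = op (E b) x - op (E a) x"
      unfolding op_inf op_uminus_fixed by (simp add: op_diff op_absorb[OF ab])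
    finally show ?thesis .
  qed
  then show ?thesis unfolding mem by auto
qed

end
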